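(* Let $k\ge 3$ be an odd integer and let $n\ge 7k-4$ be an integer. Let $T_n$ be a tree on $n$ vertices, and let $T_n+e$ be a graph obtained from $T_n$ by adding one new edge $e$ between two non-adjacent vertices of $T_n$. Then $r(T_n+e,C_k)=2n-1$.
   Context: All graphs are finite and simple. For graphs $H_1,H_2$, the Ramsey number $r(H_1,H_2)$ is the smallest positive integer $N$ such that every graph $\Gamma$ on $N$ vertices contains $H_1$ as a (not necessarily induced) subgraph or its complement $\overline{\Gamma}$ contains $H_2$ as a subgraph. $C_k$ is the cycle on $k$ vertices. *)

theory Defs
  imports Main
begin

record 'a sgraph =
  verts :: "'a set"
  edges :: "'a set set"

definition simple_graph :: "'a sgraph \<Rightarrow> bool" where
  "simple_graph G \<longleftrightarrow> finite (verts G) \<and> (\<forall>e\<in>edges G. e \<subseteq> verts G \<and> card e = 2)"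

definition complement :: "'a sgraph \<Rightarrow> 'a sgraph" where
  "complement G = \<lparr>verts = verts G, edges = {e. e \<subseteq> verts G \<and> card e = 2 \<and> e \<notin> edges G}\<rparr>"

text \<open>
  ``G contains H as a (not necessarily induced) subgraph'' means, as usual, that some subgraph of
  G is isomorphic to H; the two vertex types may differ.
\<close>

definition contains_subgraph :: "'a sgraph \<Rightarrow> 'b sgraph \<Rightarrow> bool" where
  "contains_subgraph G H \<longleftrightarrow>
     (\<exists>f. inj_on f (verts H) \<and> f ` verts H \<subseteq> verts G \<and> (\<forall>e\<in>edges H. f ` e \<in> edges G))"

text \<open>This is the cycle on k vertices only for \<open>k \<ge> 3\<close>.\<close>

definition cycle_graph :: "nat \<Rightarrow> nat sgraph" where
  "cycle_graph k = \<lparr>verts = {..<k}, edges = {{i, (i + 1) mod k} | i. i < k}\<rparr>"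

definition connected_graph :: "'a sgraph \<Rightarrow> bool" where
  "connected_graph G \<longleftrightarrow> verts G \<noteq> {} \<and>
     (\<forall>u\<in>verts G. \<forall>v\<in>verts G. (u, v) \<in> {(x, y). {x, y} \<in> edges G}\<^sup>*)"

definition acyclic_graph :: "'a sgraph \<Rightarrow> bool" where
  "acyclic_graph G \<longleftrightarrow> (\<forall>k\<ge>3. \<not> contains_subgraph G (cycle_graph k))"

definition tree_graph :: "'a sgraph \<Rightarrow> bool" where
  "tree_graph G \<longleftrightarrow> simple_graph G \<and> connected_graph G \<and> acyclic_graph G"

definition add_edge :: "'a sgraph \<Rightarrow> 'a \<Rightarrow> 'a \<Rightarrow> 'a sgraph" where
  "add_edge G u v = \<lparr>verts = verts G, edges = insert {u, v} (edges G)\<rparr>"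

text \<open>
  Every finite graph is isomorphic to one whose vertices are natural numbers, so it suffices to let
  the host graph range over those.
\<close>

definition ramsey_number :: "'a sgraph \<Rightarrow> 'b sgraph \<Rightarrow> nat" where
  "ramsey_number H1 H2 =
     (LEAST N. N > 0 \<and>
        (\<forall>\<Gamma> :: nat sgraph. simple_graph \<Gamma> \<and> card (verts \<Gamma>) = N \<longrightarrow>
           contains_subgraph \<Gamma> H1 \<or> contains_subgraph (complement \<Gamma>) H2))"

end

theory Submission
  imports Defs
begin

text \<open>
  Write \<open>k = 2 * m + 1\<close> and colour an edge of the complete graph on \<open>2 * n - 1\<close> vertices red if it
  lies in \<open>\<Gamma>\<close> and blue otherwise; assume that there is no blue \<open>C\<^sub>k\<close>. Remove, as long as possible,
  vertices with fewer than \<open>n - 1\<close> red neighbours among the remaining ones.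

  If this stops within \<open>3 * m\<close> steps, then what is left has red minimum degree \<open>n - 1\<close> and
  contains red cycles of all lengths up to \<open>n\<close>: a longest path closes up to a long cycle, a red
  cycle that cannot be shortened by one has so many blue chords that they contain a \<open>C\<^sub>k\<close>, and
  short cycles come from a depth-first search inside a red neighbourhood. The cycle of \<open>T + e\<close> can
  then be placed first and the rest greedily.

  Otherwise there are \<open>3 * m + 1\<close> hubs with about \<open>n\<close> blue neighbours each. Hubs with many common
  blue neighbours are joined by blue paths of every short even length, so an odd cycle is avoided
  only if some hub \<open>x\<close> has a set \<open>K\<close> of more than \<open>n / 2\<close> blue neighbours which is a red clique,
  and the vertices with at least two blue neighbours in \<open>K\<close> form a red clique as well. Either the
  latter has \<open>n\<close> vertices, or the other vertices, which are almost completely joined to \<open>K\<close> in red,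
  have room for \<open>T + e\<close>. The lower bound comes from two disjoint copies of \<open>K\<^bsub>n - 1\<^esub>\<close>.
\<close>

subsection \<open>Cycles and trees\<close>

text \<open>Cycles are lists so that they can be cut, reversed and spliced. The bound 3 keeps a
  single edge traversed both ways from counting as a cycle.\<close>

definition cyc :: "('a \<Rightarrow> 'a \<Rightarrow> bool) \<Rightarrow> 'a list \<Rightarrow> bool" where
  "cyc R xs \<longleftrightarrow> distinct xs \<and> 3 \<le> length xs \<and> successively R xs \<and> R (last xs) (hd xs)"

lemma cyc_subset:
  assumes "cyc R xs" and "\<And>x y. R x y \<Longrightarrow> x \<in> A"
  shows "set xs \<subseteq> A"
proof
  fix x assume "x \<in> set xs"
  then obtain ys zs where xs: "xs = ys @ x # zs" by (auto dest: split_list)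
  show "x \<in> A"
  proof (cases zs)
    case Nil
    then have "R x (hd xs)" using assms(1) by (simp add: xs cyc_def)
    then show ?thesis by (rule assms(2))
  next
    case (Cons z zs')
    then have "R x z" using assms(1) by (simp add: xs cyc_def successively_append_iff)
    then show ?thesis by (rule assms(2))
  qed
qed

lemma cyc_imp_contains_cycle_graph:
  assumes "cyc (\<lambda>x y. {x, y} \<in> edges G) xs" and "set xs \<subseteq> verts G"
  shows "contains_subgraph G (cycle_graph (length xs))"
  unfolding contains_subgraph_def
proof (intro exI conjI ballI)
  have d: "distinct xs" and l: "3 \<le> length xs" and s: "successively (\<lambda>x y. {x, y} \<in> edges G) xs"
    and c: "{last xs, hd xs} \<in> edges G"
    using assms(1) by (auto simp: cyc_def)
  show "inj_on ((!) xs) (verts (cycle_graph (length xs)))"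
    using d by (auto simp: cycle_graph_def inj_on_def nth_eq_iff_index_eq)
  show "(!) xs ` verts (cycle_graph (length xs)) \<subseteq> verts G"
    using assms(2) by (auto simp: cycle_graph_def)
  fix e assume "e \<in> edges (cycle_graph (length xs))"
  then obtain i where i: "i < length xs" "e = {i, (i + 1) mod length xs}"
    by (auto simp: cycle_graph_def)
  show "(!) xs ` e \<in> edges G"
  proof (cases "Suc i < length xs")
    case True
    then show ?thesis using i s by (auto simp: successively_conv_nth)
  next
    case False
    then have "Suc i = length xs" using i by simp
    then have "(!) xs ` e = {last xs, hd xs}"
      using i l by (subst last_conv_nth, force, subst hd_conv_nth, force) auto
    then show ?thesis using c by simp
  qed
qed

lemma rtrancl_imp_distinct_path:
  assumes "(x, y) \<in> r\<^sup>*"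
  shows "\<exists>p. p \<noteq> [] \<and> distinct p \<and> hd p = x \<and> last p = y \<and> successively (\<lambda>a b. (a, b) \<in> r) p"
  using assms
proof (induction rule: converse_rtrancl_induct)
  case base
  show ?case by (intro exI[of _ "[y]"]) auto
next
  case (step x z)
  then obtain p where p: "p \<noteq> []" "distinct p" "hd p = z" "last p = y" "successively (\<lambda>a b. (a, b) \<in> r) p"
    by blast
  show ?case
  proof (cases "x \<in> set p")
    case True
    then obtain ys zs where "p = ys @ x # zs" by (auto dest: split_list)
    then show ?thesis using p by (intro exI[of _ "x # zs"]) (auto simp: successively_append_iff)
  next
    case False
    then show ?thesis using p step
      by (intro exI[of _ "x # p"]) (auto simp: successively_Cons)
  qed
qed

lemma rtrancl_crossing:
  assumes "(x, y) \<in> r\<^sup>*" "x \<in> S" "y \<notin> S"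
  shows "\<exists>a b. (a, b) \<in> r \<and> a \<in> S \<and> b \<notin> S"
  using assms by (induction rule: rtrancl_induct) auto

section \<open>Trees grown vertex by vertex from a connected subset\<close>

locale tree =
  fixes T :: "'a sgraph"
  assumes tree: "tree_graph T"
begin

abbreviation "W \<equiv> verts T"
abbreviation "E \<equiv> edges T"

definition conn :: "'a set \<Rightarrow> bool" where
  "conn S \<longleftrightarrow> (\<forall>x\<in>S. \<forall>y\<in>S. (x, y) \<in> {(a, b). {a, b} \<in> E \<and> a \<in> S \<and> b \<in> S}\<^sup>*)"

lemma finite_W: "finite W"
  using tree by (auto simp: tree_graph_def simple_graph_def)

lemma edgeD: "{a, b} \<in> E \<Longrightarrow> a \<in> W \<and> b \<in> W \<and> a \<noteq> b"
  using tree by (force simp: tree_graph_def simple_graph_def)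

lemma edge_cases:
  assumes "e \<in> E" obtains a b where "e = {a, b}" "a \<noteq> b" "a \<in> W" "b \<in> W"
proof -
  have "card e = 2" "e \<subseteq> W" using assms tree by (auto simp: tree_graph_def simple_graph_def)
  then show ?thesis using that by (auto simp: card_2_iff)
qed

lemma conn_W: "conn W"
proof -
  have "{(a, b). {a, b} \<in> E \<and> a \<in> W \<and> b \<in> W} = {(a, b). {a, b} \<in> E}"
    using edgeD by blast
  then show ?thesis using tree by (auto simp: conn_def tree_graph_def connected_graph_def)
qed

lemma no_cyc: "\<not> cyc (\<lambda>x y. {x, y} \<in> E) xs"
proof
  assume c: "cyc (\<lambda>x y. {x, y} \<in> E) xs"
  then have "set xs \<subseteq> W" by (rule cyc_subset) (use edgeD in blast)
  then have "contains_subgraph T (cycle_graph (length xs))"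
    using c by (intro cyc_imp_contains_cycle_graph)
  then show False using tree c by (auto simp: tree_graph_def acyclic_graph_def cyc_def)
qed

lemma path_in_conn:
  assumes "conn S" "x \<in> S" "y \<in> S"
  obtains p where "p \<noteq> []" "distinct p" "hd p = x" "last p = y"
    "successively (\<lambda>a b. {a, b} \<in> E) p" "set p \<subseteq> S"
proof -
  obtain p where p: "p \<noteq> []" "distinct p" "hd p = x" "last p = y"
    and s: "successively (\<lambda>a b. (a, b) \<in> {(a, b). {a, b} \<in> E \<and> a \<in> S \<and> b \<in> S}) p"
    using rtrancl_imp_distinct_path[of x y "{(a, b). {a, b} \<in> E \<and> a \<in> S \<and> b \<in> S}"] assms
    unfolding conn_def by blast
  have "successively (\<lambda>a b. {a, b} \<in> E) p"
    using s by (rule successively_mono) auto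
  moreover have "set p \<subseteq> S"
  proof
    fix z assume "z \<in> set p"
    then obtain i where i: "i < length p" "z = p ! i" by (auto simp: in_set_conv_nth)
    show "z \<in> S"
    proof (cases "Suc i < length p")
      case True
      then show ?thesis using s i by (auto simp: successively_conv_nth)
    next
      case False
      then have "z = last p" using i
        by (metis Suc_lessI diff_Suc_1 last_conv_nth list.size(3) not_less_zero)
      then show ?thesis using p assms by simp
    qed
  qed
  ultimately show ?thesis using p that by blast
qed

text \<open>Two different neighbours of \<open>w\<close> would be joined by a path inside
  \<open>S\<close>, and \<open>w\<close> would close it to a cycle.\<close>

lemma unique_neighbour:
  assumes "conn S" "w \<notin> S" "s \<in> S" "s' \<in> S" "{s, w} \<in> E" "{s', w} \<in> E"
  shows "s' = s"
proof (rule ccontr)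
  assume ne: "s' \<noteq> s"
  obtain p where p: "p \<noteq> []" "distinct p" "hd p = s" "last p = s'"
    "successively (\<lambda>a b. {a, b} \<in> E) p" "set p \<subseteq> S"
    using path_in_conn assms by metis
  have "length p \<ge> 2"
    using p ne by (cases p; cases "tl p") auto
  then have "cyc (\<lambda>a b. {a, b} \<in> E) (w # p)"
    using p assms by (auto simp: cyc_def successively_Cons insert_commute)
  then show False using no_cyc by blast
qed

lemma conn_insert:
  assumes "conn S" "s \<in> S" "{s, w} \<in> E"
  shows "conn (insert w S)"
proof -
  let ?r = "{(a, b). {a, b} \<in> E \<and> a \<in> insert w S \<and> b \<in> insert w S}"
  have 1: "(x, y) \<in> ?r\<^sup>*" if "x \<in> S" "y \<in> S" for x y
  proof -
    have "{(a, b). {a, b} \<in> E \<and> a \<in> S \<and> b \<in> S} \<subseteq> ?r" by auto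
    then show ?thesis using assms(1) that rtrancl_mono unfolding conn_def by blast
  qed
  have 2: "(s, w) \<in> ?r" "(w, s) \<in> ?r" using assms by (auto simp: insert_commute)
  show ?thesis unfolding conn_def
  proof (intro ballI)
    fix x y assume "x \<in> insert w S" "y \<in> insert w S"
    then show "(x, y) \<in> ?r\<^sup>*"
      using 1 2 assms(2) by (smt (verit) insert_iff converse_rtrancl_into_rtrancl rtrancl.simps)
  qed
qed

text \<open>Connectedness of \<open>T\<close> supplies an edge leaving \<open>S'\<close>, and
  acyclicity makes it the only edge from \<open>w\<close> to \<open>S'\<close>. The start is a
  single vertex for the bipartition and the edge count, and a path for the embedding of
  \<open>T + e\<close>.\<close>

lemma grow_induct [consumes 3, case_names base step]:
  assumes S: "S \<subseteq> W" "S \<noteq> {}" "conn S" and base: "P S"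
    and step: "\<And>S' s w. \<lbrakk>S \<subseteq> S'; S' \<subseteq> W; conn S'; P S'; s \<in> S'; w \<in> W - S'; {s, w} \<in> E;
      \<And>s'. s' \<in> S' \<Longrightarrow> {s', w} \<in> E \<Longrightarrow> s' = s\<rbrakk> \<Longrightarrow> P (insert w S')"
  shows "P W"
proof -
  have "P W" if "S \<subseteq> S'" "S' \<subseteq> W" "conn S'" "P S'" for S'
    using that
  proof (induction "card (W - S')" arbitrary: S' rule: less_induct)
    case less
    show ?case
    proof (cases "S' = W")
      case False
      then obtain x y where "x \<in> S'" "y \<in> W - S'" using less S by auto
      moreover have "(x, y) \<in> {(a, b). {a, b} \<in> E \<and> a \<in> W \<and> b \<in> W}\<^sup>*"
        using conn_W calculation less by (auto simp: conn_def)
      ultimately obtain s w where sw: "{s, w} \<in> E" "s \<in> S'" "w \<in> W - S'"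
        using rtrancl_crossing[of x y _ S'] by blast
      have "card (W - insert w S') < card (W - S')"
        using sw finite_W by (intro psubset_card_mono) auto
      moreover have "P (insert w S')"
        using less sw unique_neighbour[OF less(4)] by (intro step) auto
      ultimately show ?thesis
        using less sw conn_insert by (intro less(1)[of "insert w S'"]) auto
    qed (use less in simp)
  qed
  then show ?thesis using S base by blast
qed

lemma bipartition: "\<exists>c :: 'a \<Rightarrow> bool. \<forall>x\<in>W. \<forall>y\<in>W. {x, y} \<in> E \<longrightarrow> c x \<noteq> c y"
proof -
  obtain r where "r \<in> W" using tree by (auto simp: tree_graph_def connected_graph_def)
  then have "{r} \<subseteq> W" "{r} \<noteq> {}" "conn {r}" by (auto simp: conn_def)
  then show ?thesis
  proof (induction rule: grow_induct)
    case base
    show ?case using edgeD[of r r] by auto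
  next
    case (step S s w)
    then obtain c :: "'a \<Rightarrow> bool" where c: "\<forall>x\<in>S. \<forall>y\<in>S. {x, y} \<in> E \<longrightarrow> c x \<noteq> c y" by blast
    show ?case
    proof (intro exI[of _ "c(w := \<not> c s)"] ballI impI)
      fix x y assume xy: "x \<in> insert w S" "y \<in> insert w S" "{x, y} \<in> E"
      then have "x \<noteq> y" using edgeD by blast
      consider "x \<in> S" "y \<in> S" | "x = w" "y \<in> S" | "y = w" "x \<in> S"
        using xy \<open>x \<noteq> y\<close> by auto
      then show "(c(w := \<not> c s)) x \<noteq> (c(w := \<not> c s)) y"
      proof cases
        case 1 then show ?thesis using c xy step(5) by auto
      next
        case 2 then show ?thesis using step(5) step(7)[of y] xy by (auto simp: insert_commute)
      next
        case 3 then show ?thesis using step(5) step(7)[of x] xy by auto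
      qed
    qed
  qed
qed

lemma card_edges: "Suc (card E) = card W"
proof -
  obtain r where "r \<in> W" using tree by (auto simp: tree_graph_def connected_graph_def)
  then have "{r} \<subseteq> W" "{r} \<noteq> {}" "conn {r}" by (auto simp: conn_def)
  then have "Suc (card {e \<in> E. e \<subseteq> W}) = card W"
  proof (induction rule: grow_induct)
    case base
    have "\<not> e \<subseteq> {r}" if "e \<in> E" for e
      using that by (rule edge_cases) auto
    then have "{e \<in> E. e \<subseteq> {r}} = {}" by blast
    then show ?case by simp
  next
    case (step S s w)
    have fin: "finite S" using step(2) finite_W by (rule finite_subset)
    have "{e \<in> E. e \<subseteq> insert w S} = insert {s, w} {e \<in> E. e \<subseteq> S}"
    proof
      show "{e \<in> E. e \<subseteq> insert w S} \<subseteq> insert {s, w} {e \<in> E. e \<subseteq> S}"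
      proof
        fix e assume e: "e \<in> {e \<in> E. e \<subseteq> insert w S}"
        show "e \<in> insert {s, w} {e \<in> E. e \<subseteq> S}"
        proof (cases "w \<in> e")
          case True
          obtain a b where ab: "e = {a, b}" "a \<noteq> b" using e by (blast elim: edge_cases)
          then obtain x where x: "e = {x, w}" "x \<noteq> w" using True by fastforce
          then have "x = s" using e step(7)[of x] by auto
          then show ?thesis using x by simp
        next
          case False
          then show ?thesis using e by auto
        qed
      qed
    next
      show "insert {s, w} {e \<in> E. e \<subseteq> S} \<subseteq> {e \<in> E. e \<subseteq> insert w S}"
        using step(4,5,6) by auto
    qed
    moreover have "finite {e \<in> E. e \<subseteq> S}" using fin by (auto intro: finite_subset[of _ "Pow S"])
    moreover have "{s, w} \<notin> {e \<in> E. e \<subseteq> S}" using step(5) by auto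
    ultimately show ?case using step(5,8) fin by simp
  qed
  moreover have "{e \<in> E. e \<subseteq> W} = E" using tree by (auto simp: tree_graph_def simple_graph_def)
  ultimately show ?thesis by simp
qed

end

subsection \<open>Embedding a tree with one additional edge\<close>

text \<open>By hypothesis each nonempty subset has an element that can be placed last: its forbidden
  values and the values of the others cannot exhaust \<open>K\<close>. Removing such elements one by
  one gives, in reverse, the order of a greedy choice.\<close>

lemma greedy_injection:
  assumes "finite X" "finite K" and fF: "\<And>x. x \<in> X \<Longrightarrow> finite (F x)"
    and c: "\<And>X'. X' \<subseteq> X \<Longrightarrow> X' \<noteq> {} \<Longrightarrow> \<exists>x\<in>X'. card (F x) + card X' \<le> card K"
  shows "\<exists>g. inj_on g X \<and> g ` X \<subseteq> K \<and> (\<forall>x\<in>X. g x \<notin> F x)"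
proof -
  have "\<exists>g. inj_on g Y \<and> g ` Y \<subseteq> K \<and> (\<forall>x\<in>Y. g x \<notin> F x)" if "Y \<subseteq> X" for Y
    using finite_subset[OF that assms(1)] that
  proof (induction Y rule: finite_psubset_induct)
    case (psubset Y)
    show ?case
    proof (cases "Y = {}")
      case False
      then obtain x where x: "x \<in> Y" "card (F x) + card Y \<le> card K"
        using c[of Y] psubset(3) by blast
      then have "Y - {x} \<subset> Y" by blast
      then obtain g where g: "inj_on g (Y - {x})" "g ` (Y - {x}) \<subseteq> K" "\<forall>y\<in>Y - {x}. g y \<notin> F y"
        using psubset(2)[of "Y - {x}"] psubset(3) by blast
      have "card (F x \<union> g ` (Y - {x})) \<le> card (F x) + card (Y - {x})"
        using card_Un_le card_image_le psubset(1)
        by (metis (no_types, lifting) add_left_mono finite_Diff order_trans)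
      also have "\<dots> < card K"
        using x psubset(1) card_Diff1_less[of Y x] by linarith
      finally have "\<not> K \<subseteq> F x \<union> g ` (Y - {x})"
        using card_mono[of "F x \<union> g ` (Y - {x})" K] fF[of x] x psubset by fastforce
      then obtain k where k: "k \<in> K" "k \<notin> F x" "k \<notin> g ` (Y - {x})" by blast
      have "inj_on (g(x := k)) Y"
        using g(1) k(3) x(1) by (auto simp: inj_on_def)
      moreover have "(g(x := k)) ` Y \<subseteq> K" using g(2) k(1) by auto
      moreover have "\<forall>y\<in>Y. (g(x := k)) y \<notin> F y" using g(3) k(2) by auto
      ultimately show ?thesis by blast
    qed auto
  qed
  then show ?thesis by blast
qed

locale unicyclic = tree T for T :: "'a sgraph" +
  fixes u v :: 'a
  assumes uv: "u \<in> W" "v \<in> W" "u \<noteq> v" "{u, v} \<notin> E"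
begin

definition adj :: "'a \<Rightarrow> 'a \<Rightarrow> bool" where
  "adj x y \<longleftrightarrow> {x, y} \<in> E \<or> {x, y} = {u, v}"

definition embeds :: "('b \<Rightarrow> 'b \<Rightarrow> bool) \<Rightarrow> 'b set \<Rightarrow> bool" where
  "embeds R Y \<longleftrightarrow> (\<exists>f. inj_on f W \<and> f ` W \<subseteq> Y \<and> (\<forall>x\<in>W. \<forall>y\<in>W. adj x y \<longrightarrow> R (f x) (f y)))"

lemma adj_sym: "adj x y \<longleftrightarrow> adj y x"
  by (simp add: adj_def insert_commute)

lemma adj_neq: "adj x y \<Longrightarrow> x \<noteq> y"
  using edgeD[of x y] uv(3) by (auto simp: adj_def)

lemma embeds_mono: "embeds R Y \<Longrightarrow> Y \<subseteq> Z \<Longrightarrow> embeds R Z"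
  unfolding embeds_def by (meson order_trans)

lemma embeds_clique:
  assumes "finite K" "card W \<le> card K" "\<And>x y. x \<in> K \<Longrightarrow> y \<in> K \<Longrightarrow> x \<noteq> y \<Longrightarrow> R x y"
  shows "embeds R K"
proof -
  obtain f where f: "f ` W \<subseteq> K" "inj_on f W"
    using card_le_inj[OF finite_W assms(1,2)] by blast
  have "R (f x) (f y)" if "x \<in> W" "y \<in> W" "adj x y" for x y
    using that f adj_neq assms(3) by (metis image_subset_iff inj_on_eq_iff)
  then show ?thesis using f unfolding embeds_def by blast
qed

text \<open>The larger colour class of the tree has at least half of the vertices. The additional
  edge may lie inside it, so \<open>u\<close> is given up.\<close>

lemma independent_set:
  obtains I where "I \<subseteq> W" "card W \<le> 2 * card I + 2" "\<And>x y. x \<in> I \<Longrightarrow> y \<in> I \<Longrightarrow> \<not> adj x y"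
proof -
  obtain c :: "'a \<Rightarrow> bool" where c: "\<forall>x\<in>W. \<forall>y\<in>W. {x, y} \<in> E \<longrightarrow> c x \<noteq> c y"
    using bipartition by blast
  define A where "A b = {x \<in> W. c x = b}" for b
  have fin: "finite (A b)" for b using finite_W by (auto simp: A_def)
  have "W = A True \<union> A False" by (auto simp: A_def)
  then have "card W \<le> card (A True) + card (A False)" by (metis card_Un_le)
  then obtain b where b: "card W \<le> 2 * card (A b)"
    by (metis add_le_mono le_trans linorder_linear mult_2)
  show ?thesis
  proof (rule that[of "A b - {u}"])
    have "card (A b) \<le> card (A b - {u}) + 1"
      using card_Suc_Diff1[OF fin, of u b] by (cases "u \<in> A b") auto
    then show "card W \<le> 2 * card (A b - {u}) + 2" using b by linarith
    show "\<not> adj x y" if "x \<in> A b - {u}" "y \<in> A b - {u}" for x y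
      using that c by (auto simp: A_def adj_def doubleton_eq_iff)
  qed (auto simp: A_def)
qed

text \<open>\<open>T + e\<close> has as many edges as vertices, and an edge between \<open>I\<close>
  and \<open>W - I\<close> determines its ordered pair.\<close>

lemma card_adj_across:
  assumes "I \<subseteq> W"
  shows "card {(x, y). x \<in> I \<and> y \<in> W - I \<and> adj x y} \<le> card W"
proof -
  let ?S = "{(x, y). x \<in> I \<and> y \<in> W - I \<and> adj x y}"
  have finE: "finite E" using card_edges tree finite_W
    by (auto simp: tree_graph_def simple_graph_def intro: finite_subset[of _ "Pow W"])
  have inj: "inj_on (\<lambda>(x, y). {x, y}) ?S"
    by (auto simp: inj_on_def doubleton_eq_iff)
  have "card ?S \<le> card (insert {u, v} E)"
    using inj by (rule card_inj_on_le) (use finE in \<open>auto simp: adj_def\<close>)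
  also have "\<dots> \<le> card W" using card_edges finE by (simp add: card_insert_if)
  finally show ?thesis .
qed

text \<open>
  An independent set \<open>I\<close> of \<open>T + e\<close> goes outside the clique \<open>K\<close>; the other vertices are placed
  in \<open>K\<close> in order of decreasing number of neighbours in \<open>I\<close>. The last one has none because \<open>I\<close>
  can be chosen non-maximal.
\<close>

lemma embeds_near_dominating:
  assumes Y: "finite Y" "card W \<le> card Y" and K: "K \<subseteq> Y" "card W + 4 \<le> 2 * card K"
    and sym: "\<And>x y. R x y \<Longrightarrow> R y x"
    and clique: "\<And>x y. x \<in> K \<Longrightarrow> y \<in> K \<Longrightarrow> x \<noteq> y \<Longrightarrow> R x y"
    and dom: "\<And>y. y \<in> Y - K \<Longrightarrow> card {k \<in> K. \<not> R y k} \<le> 1"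
  shows "embeds R Y"
proof (cases "card W \<le> card K")
  case True
  then have "embeds R K" using K(1) Y(1) clique by (intro embeds_clique) (auto intro: finite_subset)
  then show ?thesis using K(1) by (rule embeds_mono)
next
  case False
  define c where "c = card W - card K"
  have finK: "finite K" using K(1) Y(1) by (rule finite_subset)
  obtain I0 where I0: "I0 \<subseteq> W" "card W \<le> 2 * card I0 + 2" "\<And>x y. x \<in> I0 \<Longrightarrow> y \<in> I0 \<Longrightarrow> \<not> adj x y"
    using independent_set by blast
  \<comment> \<open>\<open>c\<close> vertices do not fit into \<open>K\<close>. Since
    \<open>card I0\<close> is at least \<open>card W / 2 - 1\<close> and \<open>c\<close> at most
    \<open>card W / 2 - 2\<close>, one independent vertex \<open>i0\<close> is left over, and it
    goes into \<open>K\<close>.\<close>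
  have "Suc c \<le> card I0" using I0(2) K(2) False by (simp add: c_def)
  then obtain I1 where I1: "I1 \<subseteq> I0" "card I1 = Suc c" "finite I1"
    using obtain_subset_with_card_n by metis
  then obtain i0 where i0: "i0 \<in> I1" by (metis card.empty equals0I nat.distinct(1))
  define I where "I = I1 - {i0}"
  have I: "I \<subseteq> W" "card I = c" "finite I" "i0 \<in> W - I" "\<And>x. x \<in> I \<Longrightarrow> \<not> adj x i0"
    "\<And>x y. x \<in> I \<Longrightarrow> y \<in> I \<Longrightarrow> \<not> adj x y"
    using I0 I1 i0 by (auto simp: I_def)
  have "card I \<le> card (Y - K)"
    using Y K(1) finK I(2) by (simp add: card_Diff_subset c_def)
  then obtain g0 where g0: "g0 ` I \<subseteq> Y - K" "inj_on g0 I"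
    using card_le_inj[OF I(3), of "Y - K"] Y(1) by blast
  define N where "N x = {i \<in> I. adj i x}" for x
  \<comment> \<open>\<open>F x\<close> is forbidden for \<open>x\<close> by its neighbours in
    \<open>I\<close>, which are already placed; by \<open>dom\<close> each of them forbids at most
    one vertex of \<open>K\<close>.\<close>
  define F where "F x = (\<Union>i\<in>N x. {k \<in> K. \<not> R (g0 i) k})" for x
  have finN: "finite (N x)" for x using I(3) by (simp add: N_def)
  have F_le: "card (F x) \<le> card (N x)" for x
  proof -
    have "card (F x) \<le> (\<Sum>i\<in>N x. card {k \<in> K. \<not> R (g0 i) k})"
      unfolding F_def by (rule card_UN_le[OF finN])
    also have "\<dots> \<le> (\<Sum>i\<in>N x. 1)"
      using g0(1) by (intro sum_mono dom) (auto simp: N_def)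
    finally show ?thesis by simp
  qed
  have cX: "card (W - I) = card K"
    using I(1,2,3) False by (simp add: card_Diff_subset c_def)
  have edges_le: "(\<Sum>x\<in>X. card (N x)) \<le> card W" if "X \<subseteq> W - I" for X
  proof -
    let ?S = "{(x, y). x \<in> I \<and> y \<in> W - I \<and> adj x y}"
    have fX: "finite X" using that finite_W by (auto intro: finite_subset)
    have "(\<Sum>x\<in>X. card (N x)) = card (SIGMA x:X. N x)"
      using fX finN by simp
    also have "\<dots> \<le> card ?S"
    proof (rule card_inj_on_le[where f = prod.swap])
      have "?S \<subseteq> I \<times> W" by auto
      then show "finite ?S" using I(3) finite_W by (meson finite_SigmaI finite_subset)
    qed (use that in \<open>auto simp: N_def\<close>)
    also have "\<dots> \<le> card W" using card_adj_across[OF I(1)] .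
    finally show ?thesis .
  qed
  have "\<exists>g. inj_on g (W - I) \<and> g ` (W - I) \<subseteq> K \<and> (\<forall>x\<in>W - I. g x \<notin> F x)"
  proof (rule greedy_injection)
    fix X assume X: "X \<subseteq> W - I" "X \<noteq> {}"
    have fX: "finite X" using X(1) finite_W by (auto intro: finite_subset)
    have cXle: "card X \<le> card K" using X(1) cX finite_W by (metis card_mono finite_Diff)
    show "\<exists>x\<in>X. card (F x) + card X \<le> card K"
    proof (cases "X = W - I")
      case True
      have "N i0 = {}" using I(5) by (auto simp: N_def)
      then have "card (F i0) = 0" using F_le[of i0] by simp
      then show ?thesis using True I(4) cXle by (intro bexI[of _ i0]) auto
    next
      case False
      then have lt: "card X < card K"
        using X(1) cX finite_W by (metis finite_Diff psubsetI psubset_card_mono)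
      show ?thesis
      proof (rule ccontr)
        assume contra: "\<not> ?thesis"
        have big: "card K - card X + 1 \<le> card (N x)" if "x \<in> X" for x
        proof -
          have "\<not> card (F x) + card X \<le> card K" using contra that by blast
          then show ?thesis using F_le[of x] lt by linarith
        qed
        \<comment> \<open>Every vertex of \<open>X\<close> would have at least \<open>t\<close>
          neighbours in \<open>I\<close>, so \<open>card X * t\<close> is at most
          \<open>card W\<close>. Two factors that are at least 2 have a product of at least twice
          their sum minus 4, which here is \<open>2 * card K - 2\<close> and thus exceeds
          \<open>card W\<close>. A single vertex is excluded since
          \<open>c < card K\<close>.\<close>
        define t where "t = card K - card X + 1"
        have t: "t \<ge> 2" "t + card X = card K + 1" using lt by (auto simp: t_def)
        have "card X * t \<le> card W"
        proof -
          have "card X * t = (\<Sum>x\<in>X. t)" by simp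
          also have "\<dots> \<le> (\<Sum>x\<in>X. card (N x))" using big by (intro sum_mono) (simp add: t_def)
          finally show ?thesis using edges_le[OF X(1)] by linarith
        qed
        moreover have "card X \<noteq> 1"
        proof
          assume 1: "card X = 1"
          then obtain x where "x \<in> X" by fastforce
          then have "card K \<le> card (N x)" using big[of x] 1 by simp
          also have "\<dots> \<le> c" using I(2) card_mono[OF I(3), of "N x"] by (auto simp: N_def)
          finally show False using K(2) False \<open>\<not> card W \<le> card K\<close> by (simp add: c_def)
        qed
        moreover have "card X \<ge> 1" using X(2) fX by (simp add: Suc_leI card_gt_0_iff)
        moreover have "card W + 2 \<le> card X * t" if c2: "card X \<ge> 2"
        proof -
          obtain a b where ab: "card X = 2 + a" "t = 2 + b" using le_Suc_ex[OF c2] le_Suc_ex[OF t(1)] by blast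
          have "2 * (card X + t) \<le> card X * t + 4" by (simp add: ab algebra_simps)
          then show ?thesis using t(2) K(2) by (simp add: algebra_simps)
        qed
        ultimately show False by linarith
      qed
    qed
  qed (use finite_W finK in \<open>auto simp: F_def finN\<close>)
  then obtain g where g: "inj_on g (W - I)" "g ` (W - I) \<subseteq> K" "\<forall>x\<in>W - I. g x \<notin> F x" by blast
  define f where "f x = (if x \<in> I then g0 x else g x)" for x
  have fI: "f x \<in> Y - K" if "x \<in> I" for x using that g0(1) by (auto simp: f_def)
  have fK: "f x \<in> K" if "x \<in> W - I" for x using that g(2) by (auto simp: f_def)
  have inj: "inj_on f W"
  proof (rule inj_onI)
    fix x y assume "x \<in> W" "y \<in> W" "f x = f y"
    then show "x = y"
      using fI[of x] fI[of y] fK[of x] fK[of y] g0(2) g(1)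
      by (cases "x \<in> I"; cases "y \<in> I") (auto simp: f_def inj_on_def)
  qed
  have cross: "R (f x) (f y)" if "x \<in> I" "y \<in> W - I" "adj x y" for x y
    using that g(3) fK[of y] by (auto simp: F_def N_def f_def)
  have "R (f x) (f y)" if xy: "x \<in> W" "y \<in> W" "adj x y" for x y
  proof -
    consider "x \<in> I" "y \<in> W - I" | "y \<in> I" "x \<in> W - I" | "x \<in> W - I" "y \<in> W - I"
      using xy I(6) by blast
    then show ?thesis
    proof cases
      case 3
      moreover have "f x \<noteq> f y" using inj xy adj_neq by (auto simp: inj_on_def)
      ultimately show ?thesis using fK clique by blast
    qed (use xy cross sym adj_sym in blast)+
  qed
  moreover have "f x \<in> Y" if "x \<in> W" for x
    using that fI[of x] fK[of x] K(1) by (cases "x \<in> I") auto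
  ultimately show ?thesis using inj unfolding embeds_def by (intro exI[of _ f]) auto
qed

text \<open>The segment between the ends of a chord would be closed by it to a cycle of the
  tree.\<close>

lemma path_chordless:
  assumes "distinct p" "successively (\<lambda>a b. {a, b} \<in> E) p" "i < j" "j < length p" "{p ! i, p ! j} \<in> E"
  shows "j = Suc i"
proof (rule ccontr)
  assume "j \<noteq> Suc i"
  define q where "q = drop i (take (Suc j) p)"
  have len: "length q = Suc j - i" using assms by (simp add: q_def)
  have nth: "q ! l = p ! (i + l)" if "l < length q" for l
    using that assms by (simp add: q_def)
  have "q \<noteq> []" "3 \<le> length q" using len \<open>j \<noteq> Suc i\<close> assms by auto
  moreover have "distinct q" using assms by (simp add: q_def)
  moreover have "successively (\<lambda>a b. {a, b} \<in> E) q"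
    using assms(2-4) len nth by (auto simp: successively_conv_nth)
  moreover have "hd q = p ! i" using \<open>q \<noteq> []\<close> nth[of 0] by (simp add: hd_conv_nth)
  moreover have "last q = p ! j" using \<open>q \<noteq> []\<close> nth[of "length q - 1"] len assms by (simp add: last_conv_nth)
  ultimately have "cyc (\<lambda>a b. {a, b} \<in> E) q" using assms(5) by (simp add: cyc_def insert_commute)
  then show False using no_cyc by blast
qed

lemma conn_path:
  assumes "successively (\<lambda>a b. {a, b} \<in> E) p"
  shows "conn (set p)"
  using assms
proof (induction p rule: rev_induct)
  case Nil
  show ?case by (simp add: conn_def)
next
  case (snoc x p)
  show ?case
  proof (cases "p = []")
    case True
    then show ?thesis by (simp add: conn_def)
  next
    case False
    then show ?thesis
      using snoc conn_insert[of "set p" "last p" x] by (auto simp: successively_append_iff)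
  qed
qed

text \<open>The cycle is placed first; every later vertex has exactly one neighbour placed before it.\<close>

lemma embeds_min_degree:
  assumes Q: "finite Q" and deg: "\<And>q. q \<in> Q \<Longrightarrow> card W \<le> card {y \<in> Q. R q y} + 1"
    and sym: "\<And>x y. R x y \<Longrightarrow> R y x" and irr: "\<And>x. \<not> R x x"
    and cycles: "\<And>l. 3 \<le> l \<Longrightarrow> l \<le> card W \<Longrightarrow> \<exists>cs. cyc R cs \<and> length cs = l \<and> set cs \<subseteq> Q"
  shows "embeds R Q"
proof -
  \<comment> \<open>Together with the additional edge this path is the cycle of
    \<open>T + e\<close>.\<close>
  obtain p where p: "p \<noteq> []" "distinct p" "hd p = u" "last p = v"
    "successively (\<lambda>a b. {a, b} \<in> E) p" "set p \<subseteq> W"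
    using path_in_conn[OF conn_W uv(1,2)] by blast
  have "length p \<noteq> 1" "length p \<noteq> 2" "length p \<noteq> 0"
    using p uv by (auto simp: length_Suc_conv numeral_2_eq_2)
  then have l3: "3 \<le> length p" by linarith
  have "length p \<le> card W" using p finite_W by (metis card_mono distinct_card)
  then obtain cs where cs: "cyc R cs" "length cs = length p" "set cs \<subseteq> Q"
    using cycles l3 by blast
  define f0 where "f0 x = the (map_of (zip p cs) x)" for x
  have f0: "f0 (p ! i) = cs ! i" if "i < length p" for i
    using that p(2) cs(2) by (simp add: f0_def map_of_zip_nth)
  have sub: "set p \<subseteq> W" "set p \<noteq> {}" "conn (set p)" using p conn_path by auto
  have uvp: "u \<in> set p" "v \<in> set p" using p by auto
  have "\<exists>f. inj_on f W \<and> f ` W \<subseteq> Q \<and> (\<forall>x\<in>W. \<forall>y\<in>W. adj x y \<longrightarrow> R (f x) (f y))"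
    using sub
  proof (induction rule: grow_induct)
    case base
    have dc: "distinct cs" using cs by (simp add: cyc_def)
    have inj: "inj_on f0 (set p)"
    proof (rule inj_onI)
      fix x y assume "x \<in> set p" "y \<in> set p" and eq: "f0 x = f0 y"
      then obtain i j where ij: "i < length p" "j < length p" "x = p ! i" "y = p ! j"
        by (metis in_set_conv_nth)
      then have "cs ! i = cs ! j" using eq f0 by simp
      then show "x = y" using dc ij cs(2) by (simp add: nth_eq_iff_index_eq)
    qed
    have img: "f0 ` set p \<subseteq> Q"
    proof
      fix y assume "y \<in> f0 ` set p"
      then obtain i where "i < length p" "y = f0 (p ! i)" by (metis imageE in_set_conv_nth)
      then show "y \<in> Q" using f0 cs(2,3) nth_mem[of i cs] by auto
    qed
    have edge: "R (f0 (p ! i)) (f0 (p ! j))" if "i < j" "j < length p" "adj (p ! i) (p ! j)" for i j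
    proof (cases "{p ! i, p ! j} \<in> E")
      case True
      then have "j = Suc i" using path_chordless p that by blast
      then show ?thesis using cs that f0 by (auto simp: cyc_def successively_conv_nth)
    next
      case False
      then have eq: "{p ! i, p ! j} = {u, v}" using that by (simp add: adj_def)
      have u: "u = p ! 0" and v: "v = p ! (length p - 1)"
        using p by (auto simp: hd_conv_nth last_conv_nth)
      \<comment> \<open>The additional edge joins the ends of \<open>p\<close>, so it is mapped to
        the closing edge of \<open>cs\<close>.\<close>
      have "i = 0 \<and> j = length p - 1"
      proof -
        have *: "p ! a = p ! b \<longleftrightarrow> a = b" if "a < length p" "b < length p" for a b
          using that p(2) by (simp add: nth_eq_iff_index_eq)
        have "p ! i = p ! 0 \<or> p ! j = p ! 0" "p ! i = p ! (length p - 1) \<or> p ! j = p ! (length p - 1)"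
          using eq u v by (auto simp only: doubleton_eq_iff)
        moreover have "i < length p" "0 < length p" "length p - 1 < length p" using that(1,2) by auto
        ultimately have "i = 0 \<or> j = 0" "i = length p - 1 \<or> j = length p - 1"
          using * that(2) by metis+
        then show ?thesis using that(1,2) by auto
      qed
      moreover have "R (last cs) (hd cs)" "cs \<noteq> []" using cs l3 by (auto simp: cyc_def)
      moreover have "f0 (p ! 0) = cs ! 0" "f0 (p ! (length p - 1)) = cs ! (length p - 1)"
        using l3 by (auto intro!: f0)
      ultimately show ?thesis using cs(2) by (auto simp: hd_conv_nth last_conv_nth intro: sym)
    qed
    have "R (f0 x) (f0 y)" if xy: "x \<in> set p" "y \<in> set p" "adj x y" for x y
    proof -
      obtain i j where ij: "i < length p" "j < length p" "x = p ! i" "y = p ! j"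
        using xy by (auto simp: in_set_conv_nth)
      then have "i \<noteq> j" using xy adj_neq by blast
      then show ?thesis
        using ij edge[of i j] edge[of j i] xy sym adj_sym by (metis nat_neq_iff)
    qed
    then show ?case using inj img by blast
  next
    case (step S s w)
    then obtain f where f: "inj_on f S" "f ` S \<subseteq> Q" "\<forall>x\<in>S. \<forall>y\<in>S. adj x y \<longrightarrow> R (f x) (f y)"
      by blast
    have finS: "finite S" using step(2) finite_W by (rule finite_subset)
    have "card (insert w S) \<le> card W" using step(2,5) finite_W by (intro card_mono) auto
    then have "Suc (card S) \<le> card W" using step(5) finS by simp
    moreover have "card (f ` (S - {s})) < card S"
      using card_image_le[of "S - {s}" f] finS step(4) card_Diff1_less[of S s] by fastforce
    moreover have "card W \<le> card {y \<in> Q. R (f s) y} + 1" using deg f(2) step(4) by blast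
    \<comment> \<open>At least \<open>card W - 1\<close> neighbours of \<open>f s\<close> face at
      most \<open>card W - 2\<close> occupied vertices: \<open>f s\<close> itself is not counted, as
      it is not its own neighbour.\<close>
    ultimately have "\<not> {y \<in> Q. R (f s) y} \<subseteq> f ` (S - {s})"
      using card_mono[of "f ` (S - {s})" "{y \<in> Q. R (f s) y}"] finS by fastforce
    then obtain y where y: "y \<in> Q" "R (f s) y" "y \<notin> f ` (S - {s})" by blast
    then have y': "y \<notin> f ` S" using irr by auto
    have wuv: "w \<noteq> u" "w \<noteq> v" using step(1,5) uvp by auto
    have w: "x = s" if "x \<in> S" "adj x w" for x
      using that wuv step(7)[of x] by (auto simp: adj_def doubleton_eq_iff)
    have "inj_on (f(w := y)) (insert w S)"
      using f(1) y' step(5) by (auto simp: inj_on_def)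
    moreover have "(f(w := y)) ` insert w S \<subseteq> Q" using f(2) y(1) by auto
    moreover have "R ((f(w := y)) a) ((f(w := y)) b)"
      if ab: "a \<in> insert w S" "b \<in> insert w S" "adj a b" for a b
    proof -
      have "a \<noteq> b" using ab adj_neq by blast
      then consider "a \<in> S" "b \<in> S" | "a \<in> S" "b = w" | "a = w" "b \<in> S" using ab by blast
      then show ?thesis
      proof cases
        case 1 then show ?thesis using f(3) ab step(5) by auto
      next
        case 2 then show ?thesis using w[of a] ab y(2) step(5) by auto
      next
        case 3 then show ?thesis using w[of b] ab y(2) step(5) sym adj_sym by auto
      qed
    qed
    ultimately show ?case by blast
  qed
  then show ?thesis unfolding embeds_def .
qed

end

subsection \<open>Long paths and cycles\<close>

text \<open>Consecutive entries of \<open>hs\<close> are linked through distinct common neighbours,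
  chosen greedily from the end of the list. Each time fewer than \<open>d\<close> vertices of
  \<open>U\<close> lie in \<open>X\<close> or are used already; the last clause of the conclusion
  keeps this count in the induction.\<close>

lemma alternating_path:
  assumes "hs \<noteq> []" "distinct hs" "set hs \<inter> U = {}" "finite U"
    and "successively (\<lambda>x y. d \<le> card {c \<in> U. r x c \<and> r c y}) hs"
    and "card (X \<inter> U) + length hs \<le> d + 1"
  shows "\<exists>ps. ps \<noteq> [] \<and> distinct ps \<and> hd ps = hd hs \<and> last ps = last hs \<and> length ps + 1 = 2 * length hs \<and>
    successively r ps \<and> set ps \<subseteq> set hs \<union> (U - X) \<and> card (set ps \<inter> U) + 1 = length hs"
  using assms
proof (induction hs rule: induct_list012)
  case (2 h)
  then show ?case by (intro exI[of _ "[h]"]) auto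
next
  case (3 h h' hs)
  then obtain ps where ps: "ps \<noteq> []" "distinct ps" "hd ps = h'" "last ps = last (h' # hs)"
    "length ps + 1 = 2 * length (h' # hs)" "successively r ps" "set ps \<subseteq> set (h' # hs) \<union> (U - X)"
    "card (set ps \<inter> U) + 1 = length (h' # hs)"
    by auto
  let ?C = "{c \<in> U. r h c \<and> r c h'}"
  have "card (X \<inter> U \<union> (set ps \<inter> U)) \<le> card (X \<inter> U) + card (set ps \<inter> U)"
    by (rule card_Un_le)
  also have "\<dots> < d" using ps(8) 3(8) by simp
  also have "d \<le> card ?C" using 3(7) by simp
  finally have "\<not> ?C \<subseteq> X \<inter> U \<union> (set ps \<inter> U)"
    using card_mono[of "X \<inter> U \<union> (set ps \<inter> U)" ?C] 3(6) by fastforce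
  then obtain c where c: "c \<in> U" "r h c" "r c h'" "c \<notin> X" "c \<notin> set ps" by blast
  have h: "h \<notin> set ps" "h \<noteq> c" "h \<notin> U" using ps(7) 3(4,5) c(1) by auto
  have "set (h # c # ps) \<inter> U = insert c (set ps \<inter> U)" using c h by auto
  then have "card (set (h # c # ps) \<inter> U) = Suc (card (set ps \<inter> U))" using c by simp
  then show ?case
    using ps c h by (intro exI[of _ "h # c # ps"]) (auto simp: successively_Cons)
qed simp

text \<open>
  A state of depth-first search: \<open>D\<close> is the set of finished vertices, \<open>ps\<close> the stack, and no edge
  leads from \<open>D\<close> to an unvisited vertex. The search is stopped when \<open>D\<close> and the unvisited
  vertices are equally many.
\<close>

lemma disjoint_sets_without_edges:
  assumes M: "finite M" and no: "\<And>ps. distinct ps \<Longrightarrow> set ps \<subseteq> M \<Longrightarrow> successively r ps \<Longrightarrow> length ps < s"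
  shows "\<exists>X Y. X \<subseteq> M \<and> Y \<subseteq> M \<and> X \<inter> Y = {} \<and> card X = card Y \<and> card M + 1 \<le> 2 * card X + s \<and>
    (\<forall>x\<in>X. \<forall>y\<in>Y. \<not> r x y)"
proof -
  define I where "I z \<longleftrightarrow> (case z of (D, ps) \<Rightarrow> D \<subseteq> M \<and> distinct ps \<and> set ps \<subseteq> M - D \<and> successively r ps \<and>
    (\<forall>x\<in>D. \<forall>y\<in>M - D - set ps. \<not> r x y) \<and> card D \<le> card (M - D - set ps))" for z
  \<comment> \<open>Pushing an unvisited vertex and moving the top of the stack to \<open>D\<close>
    both raise \<open>f\<close> by 1. As \<open>f\<close> is bounded, a state maximising it exists;
    neither move can be possible there, which forces the balance.\<close>
  define f where "f z = (case z of (D, ps) \<Rightarrow> 2 * card D + length ps)" for z :: "'a set \<times> 'a list"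
  have "I ({}, [])" by (simp add: I_def)
  moreover have "\<forall>z. I z \<longrightarrow> f z < 2 * card M + s + 1"
  proof (intro allI impI)
    fix z assume z: "I z"
    obtain D ps where [simp]: "z = (D, ps)" by fastforce
    have "card D \<le> card M" using z M by (auto simp: I_def intro: card_mono)
    moreover have "length ps < s" using z by (intro no) (auto simp: I_def)
    ultimately show "f z < 2 * card M + s + 1" by (simp add: f_def)
  qed
  ultimately obtain z where z: "I z" "\<And>z'. I z' \<Longrightarrow> f z' \<le> f z"
    using ex_has_greatest_nat[of I _ f] by blast
  obtain D ps where zz: "z = (D, ps)" by fastforce
  define U where "U = M - D - set ps"
  have D: "D \<subseteq> M" "distinct ps" "set ps \<subseteq> M - D" "successively r ps" "\<forall>x\<in>D. \<forall>y\<in>U. \<not> r x y" "card D \<le> card U"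
    using z(1) by (auto simp: I_def zz U_def)
  have fin: "finite U" "finite D" using M D(1) by (auto simp: U_def intro: finite_subset)
  have "card D = card U"
  proof (rule ccontr)
    assume "card D \<noteq> card U"
    then have lt: "Suc (card D) \<le> card U" using D(6) by simp
    have push: False if u: "u \<in> U" "ps \<noteq> [] \<Longrightarrow> r (last ps) u" for u
    proof -
      have "M - D - set (ps @ [u]) = U - {u}" by (auto simp: U_def)
      moreover have "card D \<le> card (U - {u})" using lt u fin by simp
      ultimately have "I (D, ps @ [u])"
        using D u by (auto simp: I_def successively_append_iff U_def)
      then show False using z(2)[of "(D, ps @ [u])"] by (simp add: f_def zz)
    qed
    have "U \<noteq> {}" using lt by auto
    then have ne: "ps \<noteq> []" using push by blast
    then have nr: "\<not> r (last ps) u" if "u \<in> U" for u using push that by blast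
    have ps: "ps = butlast ps @ [last ps]" using ne by simp
    have dl: "last ps \<notin> set (butlast ps)" "distinct (butlast ps)"
      using D(2) ps by (metis distinct_append not_distinct_conv_prefix, metis distinct_butlast)
    have sets: "set ps = insert (last ps) (set (butlast ps))"
      by (subst ps) auto
    have "M - insert (last ps) D - set (butlast ps) = U" using sets by (auto simp: U_def)
    moreover have "successively r (butlast ps)"
      using D(4) ps by (metis successively_append_iff)
    moreover have "last ps \<notin> D" "last ps \<in> M" using D(3) sets by auto
    ultimately have "I (insert (last ps) D, butlast ps)"
      using D sets dl lt nr fin by (auto simp: I_def)
    moreover have "f (insert (last ps) D, butlast ps) = f z + 1"
      using \<open>last ps \<notin> D\<close> fin ne by (auto simp: f_def zz)
    ultimately show False using z(2) by fastforce
  qed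
  moreover have "card M = card D + card U + length ps"
  proof -
    have "M = D \<union> U \<union> set ps" using D by (auto simp: U_def)
    moreover have "card (D \<union> U) = card D + card U" using fin by (intro card_Un_disjoint) (auto simp: U_def)
    moreover have "card (D \<union> U \<union> set ps) = card (D \<union> U) + card (set ps)"
      using fin D(3) by (intro card_Un_disjoint) (auto simp: U_def)
    ultimately show ?thesis using D(2) by (simp add: distinct_card)
  qed
  moreover have "length ps < s" using D by (intro no) auto
  ultimately show ?thesis
    using D by (intro exI[of _ D] exI[of _ U]) (auto simp: U_def)
qed

text \<open>All neighbours of the first vertex of a longest path lie on the path, at positive
  positions. The farthest of these at least \<open>d\<close> neighbours has position at least
  \<open>d\<close> and closes a cycle.\<close>

lemma long_cycle:
  assumes Q: "finite Q" "Q \<noteq> {}" and deg: "\<And>q. q \<in> Q \<Longrightarrow> d \<le> card {y \<in> Q. r q y}" and d: "2 \<le> d"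
    and sym: "\<And>x y. r x y \<Longrightarrow> r y x" and irr: "\<And>x. \<not> r x x"
  shows "\<exists>cs. cyc r cs \<and> set cs \<subseteq> Q \<and> d + 1 \<le> length cs"
proof -
  define P where "P ps \<longleftrightarrow> ps \<noteq> [] \<and> distinct ps \<and> set ps \<subseteq> Q \<and> successively r ps" for ps
  obtain q where "q \<in> Q" using Q by blast
  then have "P [q]" by (simp add: P_def)
  moreover have "\<forall>ps. P ps \<longrightarrow> length ps < card Q + 1"
    using Q(1) by (metis P_def card_mono distinct_card less_Suc_eq_le Suc_eq_plus1)
  ultimately obtain ps where ps: "P ps" "\<And>ps'. P ps' \<Longrightarrow> length ps' \<le> length ps"
    using ex_has_greatest_nat[of P _ length] by blast
  define J where "J = {i. i < length ps \<and> r (hd ps) (ps ! i)}"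
  have hd: "hd ps \<in> Q" "ps \<noteq> []" using ps by (auto simp: P_def)
  have sub: "{y \<in> Q. r (hd ps) y} \<subseteq> (!) ps ` J"
  proof
    fix y assume y: "y \<in> {y \<in> Q. r (hd ps) y}"
    have "y \<in> set ps"
    proof (rule ccontr)
      assume "y \<notin> set ps"
      then have "P (y # ps)" using ps(1) y sym by (auto simp: P_def successively_Cons)
      then show False using ps(2) by fastforce
    qed
    then show "y \<in> (!) ps ` J" using y by (auto simp: J_def in_set_conv_nth)
  qed
  have finJ: "finite J" by (simp add: J_def)
  have "d \<le> card ((!) ps ` J)" using deg[OF hd(1)] card_mono[OF _ sub] finJ by fastforce
  then have dJ: "d \<le> card J" using card_image_le[OF finJ, of "(!) ps"] by linarith
  then have "J \<noteq> {}" using d by auto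
  define j where "j = Max J"
  have j: "j \<in> J" "\<And>i. i \<in> J \<Longrightarrow> i \<le> j"
    using finJ \<open>J \<noteq> {}\<close> by (auto simp: j_def)
  have "0 \<notin> J" using irr hd by (auto simp: J_def hd_conv_nth)
  then have "J \<subseteq> {1..j}" using j by (auto simp: Suc_le_eq intro: gr0I)
  then have "d \<le> j" using dJ card_mono[of "{1..j}" J] by simp
  have jl: "j < length ps" "r (hd ps) (ps ! j)" using j by (auto simp: J_def)
  let ?c = "take (Suc j) ps"
  have "last ?c = ps ! j" using jl by (simp add: take_Suc_conv_app_nth)
  moreover have "hd ?c = hd ps" using hd by (simp add: hd_conv_nth)
  moreover have "successively r ?c"
    using ps(1) by (auto simp: P_def successively_conv_nth)
  ultimately have "cyc r ?c" using ps(1) jl d \<open>d \<le> j\<close> sym by (auto simp: cyc_def P_def)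
  moreover have "set ?c \<subseteq> Q" using ps(1) set_take_subset[of "Suc j" ps] by (auto simp: P_def)
  ultimately show ?thesis using jl \<open>d \<le> j\<close> by (intro exI[of _ ?c]) simp
qed

lemma obtain_distinct_list:
  assumes "finite X" "j \<le> card X"
  obtains xs where "distinct xs" "set xs \<subseteq> X" "length xs = j"
proof -
  obtain A where "A \<subseteq> X" "card A = j" "finite A" using obtain_subset_with_card_n[OF assms(2)] by metis
  then show ?thesis using that finite_distinct_list[of A] by (metis distinct_card)
qed

lemma successively_if_all:
  assumes "distinct xs" "\<And>x y. x \<in> set xs \<Longrightarrow> y \<in> set xs \<Longrightarrow> x \<noteq> y \<Longrightarrow> r x y"
  shows "successively r xs"
  using assms by (auto simp: successively_conv_nth nth_eq_iff_index_eq)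

text \<open>A path alternates between \<open>(l + 1) div 2\<close> vertices of \<open>X\<close> and
  other vertices of \<open>Z\<close>. Its ends are adjacent, which settles odd \<open>l\<close>; for
  even \<open>l\<close> one more vertex of \<open>Z\<close> closes it.\<close>

lemma cycle_in_dominated_set:
  assumes Z: "finite Z" "X \<subseteq> Z" and l: "3 \<le> l" "l \<le> card Z" "l \<le> 2 * card X"
    and sym: "\<And>x y. r x y \<Longrightarrow> r y x"
    and dom: "\<And>x z. x \<in> X \<Longrightarrow> z \<in> Z \<Longrightarrow> x \<noteq> z \<Longrightarrow> r x z"
  shows "\<exists>cs. cyc r cs \<and> length cs = l \<and> set cs \<subseteq> Z"
proof -
  define j where "j = (l + 1) div 2"
  have j: "2 \<le> j" "j \<le> card X" using l by (auto simp: j_def)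
  have finX: "finite X" using Z finite_subset by blast
  obtain hs where hs: "distinct hs" "set hs \<subseteq> X" "length hs = j"
    using obtain_distinct_list[OF finX j(2)] by blast
  define U where "U = Z - set hs"
  have cU: "card U = card Z - j" "finite U"
    using Z hs by (auto simp: U_def card_Diff_subset distinct_card)
  have C: "{c \<in> U. r x c \<and> r c y} = U" if "x \<in> set hs" "y \<in> set hs" for x y
  proof -
    have "r x c \<and> r c y" if "c \<in> U" for c
      using that \<open>x \<in> set hs\<close> \<open>y \<in> set hs\<close> hs dom sym unfolding U_def by blast
    then show ?thesis by blast
  qed
  have "\<exists>ps. ps \<noteq> [] \<and> distinct ps \<and> hd ps = hd hs \<and> last ps = last hs \<and> length ps + 1 = 2 * length hs \<and>
      successively r ps \<and> set ps \<subseteq> set hs \<union> (U - {}) \<and> card (set ps \<inter> U) + 1 = length hs"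
  proof (rule alternating_path[where d = "card U"])
    show "hs \<noteq> []" using hs j by auto
    show "set hs \<inter> U = {}" by (auto simp: U_def)
    show "successively (\<lambda>x y. card U \<le> card {c \<in> U. r x c \<and> r c y}) hs"
      using hs(1) by (rule successively_if_all) (simp only: C order_refl)
    show "card ({} \<inter> U) + length hs \<le> card U + 1" using cU hs l by (auto simp: j_def)
  qed (use hs cU in auto)
  then obtain ps where ps: "ps \<noteq> []" "distinct ps" "hd ps = hd hs" "last ps = last hs" "length ps + 1 = 2 * j"
    "successively r ps" "set ps \<subseteq> set hs \<union> U" "card (set ps \<inter> U) + 1 = j" using hs(3) by auto
  have "hs \<noteq> []" using hs j by auto
  then have hds: "hd hs \<in> set hs" "last hs \<in> set hs" by auto
  have "hd hs \<noteq> last hs" using hs j by (cases hs) auto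
  have subZ: "set ps \<subseteq> Z" using ps(7) hs(2) Z(2) by (auto simp: U_def)
  show ?thesis
  proof (cases "odd l")
    case True
    then have "length ps = l" using ps(5) by (auto simp: j_def elim: oddE)
    moreover have "r (last ps) (hd ps)" using dom hds \<open>hd hs \<noteq> last hs\<close> hs(2) Z(2) ps by (metis subsetD)
    ultimately have "cyc r ps" using ps l by (auto simp: cyc_def)
    then show ?thesis using \<open>length ps = l\<close> subZ by blast
  next
    case False
    then have l2: "l = 2 * j" by (auto simp: j_def)
    have "\<not> U \<subseteq> set ps \<inter> U"
    proof
      assume "U \<subseteq> set ps \<inter> U"
      then have "card U \<le> card (set ps \<inter> U)" using cU by (intro card_mono) auto
      then show False using ps(8) cU l l2 by auto
    qed
    then obtain z where z: "z \<in> U" "z \<notin> set ps" by blast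
    have "r z (hd ps)" "r (last ps) z"
      using z(1) dom sym hds hs(2) ps(3,4) unfolding U_def by (metis DiffE subsetD)+
    then have "cyc r (z # ps)" using ps z l l2 by (auto simp: cyc_def successively_Cons)
    moreover have "length (z # ps) = l" using ps(5) l2 by simp
    moreover have "set (z # ps) \<subseteq> Z" using subZ z(1) by (simp add: U_def)
    ultimately show ?thesis by blast
  qed
qed

lemma cyc_rotate: "cyc r xs \<Longrightarrow> cyc r (rotate i xs)"
proof (induction i)
  case (Suc i)
  have "cyc r (rotate1 ys)" if "cyc r ys" for ys
  proof (cases ys)
    case (Cons a zs)
    then have "zs \<noteq> []" using that by (auto simp: cyc_def)
    then show ?thesis using that Cons by (auto simp: cyc_def successively_append_iff successively_Cons)
  qed (use that in simp)
  then show ?case using Suc by simp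
qed simp

subsection \<open>Colourings without a blue odd cycle\<close>

text \<open>Rerouting along crossing chords: traverse \<open>P\<close>, jump to \<open>x\<close>,
  run back through \<open>Q\<close>, and return from \<open>hd Q\<close> to
  \<open>hd P\<close>.\<close>

lemma cyc_cross:
  assumes sym: "\<And>x y. r x y \<Longrightarrow> r y x"
    and "distinct (x # P @ Q)" "P \<noteq> []" "Q \<noteq> []" "2 \<le> length P + length Q"
    and "successively r P" "successively r Q" "r x (last P)" "r x (last Q)" "r (hd P) (hd Q)"
  shows "cyc r (P @ x # rev Q)"
proof -
  have "successively r (rev Q)"
    using assms(7) sym by (auto elim: successively_mono)
  then show ?thesis using assms
    by (auto simp: cyc_def successively_append_iff successively_Cons hd_rev last_rev)
qed

text \<open>\<open>B\<close> is blue and the cycle length is \<open>k = 2 * m + 1\<close>, so that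
  \<open>14 * m + 3\<close> is \<open>7 * k - 4\<close>.\<close>

locale two_coloured =
  fixes V :: "'v set" and B :: "'v \<Rightarrow> 'v \<Rightarrow> bool" and m n :: nat
  assumes finite_V: "finite V" and card_V: "card V + 1 = 2 * n" and n: "14 * m + 3 \<le> n" and m: "1 \<le> m"
    and B_sym: "B x y \<Longrightarrow> B y x" and B_irrefl: "\<not> B x x" and B_V: "B x y \<Longrightarrow> x \<in> V"
    and no_blue: "cyc B xs \<Longrightarrow> length xs \<noteq> 2 * m + 1"
begin

definition R :: "'v \<Rightarrow> 'v \<Rightarrow> bool" where
  "R x y \<longleftrightarrow> x \<in> V \<and> y \<in> V \<and> x \<noteq> y \<and> \<not> B x y"

lemma R_sym: "R x y \<Longrightarrow> R y x"
  using B_sym by (auto simp: R_def)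

lemma R_irrefl: "\<not> R x x"
  by (simp add: R_def)

lemma B_V2: "B x y \<Longrightarrow> y \<in> V"
  using B_sym B_V by blast

text \<open>
  If the red cycle cannot be shortened by one, its chords of span \<open>2\<close> are blue, hence those of span
  \<open>4 * m\<close> are red, because \<open>2 * m\<close> chords of span \<open>2\<close> would complete a blue cycle. Rerouting along
  two crossing chords shows that those of span \<open>4 * m + 1\<close> and \<open>4 * m - 1\<close> are blue. The blue cycle
  runs through the positions \<open>2, 4, \<dots>, 2 * m, 6 * m + 1, 6 * m - 1, \<dots>, 4 * m + 1\<close>.
\<close>

lemma shorten_cycle:
  assumes c: "cyc R xs" and L: "6 * m + 2 \<le> length xs"
  shows "\<exists>ys. cyc R ys \<and> set ys \<subseteq> set xs \<and> length ys + 1 = length xs"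
proof (rule ccontr)
  assume nope: "\<not> ?thesis"
  define x where "x i = xs ! i" for i
  have len: "length xs > 2" using L m by linarith
  have dx: "distinct xs" using c by (simp add: cyc_def)
  have inj: "x i = x j \<longleftrightarrow> i = j" if "i < length xs" "j < length xs" for i j
    using that dx by (simp add: x_def nth_eq_iff_index_eq)
  have "set xs \<subseteq> V" using c by (rule cyc_subset) (simp add: R_def)
  then have xV: "x i \<in> V" if "i < length xs" for i using that by (auto simp: x_def)
  have blueI: "B (x i) (x j)" if "\<not> R (x i) (x j)" "i < length xs" "j < length xs" "i \<noteq> j" for i j
    using that xV inj by (auto simp: R_def)
  \<comment> \<open>After a rotation the chords in question start near position 0 and no index wraps
    around.\<close>
  have rot: "\<exists>ys. length ys = length xs \<and> set ys = set xs \<and> cyc R ys \<and> (\<forall>j. i + j < length xs \<longrightarrow> ys ! j = x (i + j))" for i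
    using cyc_rotate[OF c, of i]
    by (intro exI[of _ "rotate i xs"]) (auto simp: nth_rotate x_def)
  have span2: "B (x i) (x (i + 2))" if i: "i + 2 < length xs" for i
  proof (rule blueI)
    show "\<not> R (x i) (x (i + 2))"
    proof
      assume r: "R (x i) (x (i + 2))"
      obtain ys where ys: "length ys = length xs" "set ys = set xs" "cyc R ys" "\<forall>j. i + j < length xs \<longrightarrow> ys ! j = x (i + j)"
        using rot by blast
      obtain a b c zs where abc: "ys = a # b # c # zs"
        using ys(1) len by (cases ys; cases "tl ys"; cases "tl (tl ys)") auto
      have "ys ! 0 = x i" "ys ! 2 = x (i + 2)" using ys(4) i by auto
      then have "a = x i" "c = x (i + 2)" by (auto simp: abc)
      moreover have "4 \<le> length ys" using L m ys(1) by linarith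
      ultimately have "cyc R (a # c # zs)"
        using ys(3) r by (auto simp: cyc_def abc successively_Cons)
      then show False using nope ys(1,2) unfolding abc by fastforce
    qed
  qed (use i in auto)
  have span4m: "R (x i) (x (i + 4 * m))" if i: "i + 4 * m < length xs" for i
  proof (rule ccontr)
    assume "\<not> ?thesis"
    then have b: "B (x i) (x (i + 4 * m))" using blueI i m by force
    define q where "q = map (\<lambda>t. x (i + 2 * t)) [0..<2 * m + 1]"
    have "distinct q"
      using i inj by (auto simp: q_def distinct_map inj_on_def)
    moreover have "successively B q"
      using span2 i by (auto simp: q_def successively_conv_nth simp del: upt_Suc)
    moreover have "hd q = x i" by (simp add: q_def hd_map del: upt_Suc)
    moreover have "last q = x (i + 4 * m)" "length q = 2 * m + 1"
      by (auto simp: q_def)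
    ultimately have "cyc B q" using b B_sym m by (simp add: cyc_def)
    then show False using no_blue \<open>length q = 2 * m + 1\<close> by blast
  qed
  have cross: "B (x (i + 1)) (x (i + 4 * m + 2)) \<and> B (x (i + 2)) (x (i + 4 * m + 1))"
    if i: "i + 4 * m + 2 < length xs" for i
  proof -
    obtain ys where ys: "length ys = length xs" "set ys = set xs" "cyc R ys" "\<forall>j. i + j < length xs \<longrightarrow> ys ! j = x (i + j)"
      using rot by blast
    have ysj: "ys ! j = x (i + j)" if "j \<le> 4 * m + 2" for j using ys(4) i that by auto
    have chord: "R (ys ! 0) (ys ! (4 * m))" using span4m[of i] i ysj by simp
    have dys: "distinct ys" and sys: "successively R ys" and cl: "R (last ys) (hd ys)"
      using ys(3) by (auto simp: cyc_def)
    have ne: "ys \<noteq> []" using ys(1) len by auto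
    have lenys: "4 * m + 2 < length ys" using ys(1) i by simp
    \<comment> \<open>The rerouted cycle omits exactly one vertex: position \<open>4 * m + 1\<close>
      if \<open>a = 0\<close>, and position 1 if \<open>a = 1\<close>.\<close>
    have *: False if "a \<le> 1" "R (ys ! (a + 1)) (ys ! (4 * m + 2 - a))" for a
    proof -
      define P where "P = drop (a + 1) (take (4 * m + 1) ys)"
      define Q where "Q = drop (4 * m + 2 - a) ys"
      have lP: "length P = 4 * m - a" and lQ: "length Q = length ys - (4 * m + 2 - a)"
        using lenys by (auto simp: P_def Q_def)
      have nP: "P ! t = ys ! (a + 1 + t)" if "t < length P" for t using that lenys by (simp add: P_def)
      have nQ: "Q ! t = ys ! (4 * m + 2 - a + t)" if "t < length Q" for t using that lenys by (simp add: Q_def)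
      have neP: "P \<noteq> []" "Q \<noteq> []" using lP lQ lenys m \<open>a \<le> 1\<close> by auto
      have hdP: "hd P = ys ! (a + 1)" using nP[of 0] neP by (simp add: hd_conv_nth)
      have lastP: "last P = ys ! (4 * m)" using nP[of "length P - 1"] neP lP m \<open>a \<le> 1\<close> by (simp add: last_conv_nth)
      have hdQ: "hd Q = ys ! (4 * m + 2 - a)" using nQ[of 0] neP by (simp add: hd_conv_nth)
      have lastQ: "last Q = last ys" using lenys by (simp add: Q_def)
      have dist: "distinct (ys ! 0 # P @ Q)"
      proof -
        have "P @ Q = map ((!) ys) ([a + 1..<4 * m + 1] @ [4 * m + 2 - a..<length ys])"
        proof -
          have "P = map ((!) ys) [a + 1..<4 * m + 1]"
            using lP nP by (intro nth_equalityI) (auto simp del: upt_Suc)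
          moreover have "Q = map ((!) ys) [4 * m + 2 - a..<length ys]"
            using lQ nQ by (intro nth_equalityI) (auto simp del: upt_Suc)
          ultimately show ?thesis by simp
        qed
        then have "ys ! 0 # P @ Q = map ((!) ys) (0 # [a + 1..<4 * m + 1] @ [4 * m + 2 - a..<length ys])"
          by simp
        moreover have "distinct (map ((!) ys) (0 # [a + 1..<4 * m + 1] @ [4 * m + 2 - a..<length ys]))"
          unfolding distinct_map
        proof
          show "distinct (0 # [a + 1..<4 * m + 1] @ [4 * m + 2 - a..<length ys])"
            using \<open>a \<le> 1\<close> m by auto
          show "inj_on ((!) ys) (set (0 # [a + 1..<4 * m + 1] @ [4 * m + 2 - a..<length ys]))"
            using dys lenys by (intro inj_on_nth) auto
        qed
        ultimately show ?thesis by metis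
      qed
      have "successively R P"
        using sys lP nP lenys by (auto simp: successively_conv_nth)
      moreover have "successively R Q"
        using sys lQ nQ lenys by (auto simp: successively_conv_nth)
      moreover have "R (ys ! 0) (last Q)" using cl ne R_sym lastQ by (simp add: hd_conv_nth)
      moreover have "R (hd P) (hd Q)" using that(2) hdP hdQ by simp
      moreover have "R (ys ! 0) (last P)" using chord lastP by simp
      moreover have "2 \<le> length P + length Q" using lP lQ lenys m \<open>a \<le> 1\<close> by linarith
      ultimately have "cyc R (P @ ys ! 0 # rev Q)"
        using dist neP by (intro cyc_cross) (rule R_sym)
      moreover have "set (P @ ys ! 0 # rev Q) \<subseteq> set ys"
        using ne by (auto simp: P_def Q_def dest: in_set_dropD in_set_takeD)
      moreover have "length (P @ ys ! 0 # rev Q) + 1 = length xs"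
        using lP lQ lenys ys(1) \<open>a \<le> 1\<close> m by auto
      ultimately show False using nope ys(2) by blast
    qed
    have "\<not> R (x (i + 1)) (x (i + 4 * m + 2))" using *[of 0] ysj[of 1] ysj[of "4 * m + 2"] by (auto simp: add.assoc)
    moreover have "\<not> R (x (i + 2)) (x (i + 4 * m + 1))"
      using *[of 1] ysj[of 2] ysj[of "4 * m + 1"] by (auto simp: add.assoc numeral_2_eq_2)
    ultimately show ?thesis using blueI i m by auto
  qed
  define js where "js = map (\<lambda>t. 2 + 2 * t) [0..<m] @ map (\<lambda>t. 6 * m + 1 - 2 * t) [0..<m + 1]"
  have js: "set js \<subseteq> {..<length xs}" "distinct js" "length js = 2 * m + 1"
  proof -
    have "distinct (map (\<lambda>t. 6 * m + 1 - 2 * t) [0..<m + 1])"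
      by (auto simp: distinct_map inj_on_def)
    moreover have "distinct (map (\<lambda>t. 2 + 2 * t) [0..<m])"
      by (auto simp: distinct_map inj_on_def)
    moreover have "set (map (\<lambda>t. 2 + 2 * t) [0..<m]) \<inter> set (map (\<lambda>t. 6 * m + 1 - 2 * t) [0..<m + 1]) = {}"
      by auto
    ultimately show "distinct js" by (simp add: js_def)
    show "set js \<subseteq> {..<length xs}" using L m by (auto simp: js_def)
  qed (simp add: js_def)
  have "distinct (map x js)"
    using js inj by (auto simp: distinct_map inj_on_def)
  moreover have "successively B (map x js)"
  proof -
    have "successively (\<lambda>i j. B (x i) (x j)) (map (\<lambda>t. 2 + 2 * t) [0..<m])"
      using span2 L by (auto simp: successively_conv_nth)
    moreover have "successively (\<lambda>i j. B (x i) (x j)) (map (\<lambda>t. 6 * m + 1 - 2 * t) [0..<m + 1])"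
    proof -
      have "B (x (6 * m + 1 - 2 * t)) (x (6 * m + 1 - 2 * Suc t))" if "Suc t < m + 1" for t
      proof -
        have "6 * m + 1 - 2 * t = (6 * m + 1 - 2 * Suc t) + 2" using that by auto
        then show ?thesis using span2[of "6 * m + 1 - 2 * Suc t"] L B_sym by auto
      qed
      then show ?thesis by (auto simp: successively_conv_nth simp del: upt_Suc mult_Suc_right)
    qed
    \<comment> \<open>This link has span \<open>4 * m + 1\<close> and the closing one has span
      \<open>4 * m - 1\<close>; all others have span 2. The position \<open>6 * m + 1\<close> is the
      reason for the bound on the length of \<open>xs\<close>.\<close>
    moreover have "B (x (2 * m)) (x (6 * m + 1))"
      using cross[of "2 * m - 1"] L m by auto
    moreover have "last (map (\<lambda>t. 2 + 2 * t) [0..<m]) = 2 * m" using m by (simp add: last_map)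
    moreover have "hd (map (\<lambda>t. 6 * m + 1 - 2 * t) [0..<m + 1]) = 6 * m + 1"
      by (simp add: hd_map del: upt_Suc)
    ultimately have "successively (\<lambda>i j. B (x i) (x j)) js"
      unfolding js_def successively_append_iff by (simp only: simp_thms)
    then show ?thesis by (simp add: successively_map)
  qed
  moreover have "B (last (map x js)) (hd (map x js))"
  proof -
    have "last js = 4 * m + 1" "hd js = 2" using m by (auto simp: js_def last_map hd_map)
    moreover have "B (x 2) (x (4 * m + 1))" using cross[of 0] L m by (simp add: numeral_2_eq_2)
    moreover have "js \<noteq> []" using js(3) by auto
    ultimately show ?thesis using B_sym by (simp add: last_map hd_map)
  qed
  ultimately have "cyc B (map x js)" using js(3) m by (simp add: cyc_def)
  then show False using no_blue js(3) by fastforce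
qed

end

section \<open>Counting facts and paths in dense graphs\<close>

lemma card_insert_le_Suc: "card (insert x A) \<le> Suc (card A)"
  by (cases "finite A") (auto simp: card_insert_if)

lemma ex_other_element:
  assumes "2 \<le> card A"
  shows "\<exists>x\<in>A. x \<noteq> y"
proof (rule ccontr)
  assume "\<not> ?thesis"
  then have "A \<subseteq> {y}" by blast
  then show False using card_mono[of "{y}" A] assms by simp
qed

text \<open>Vertices are chosen greedily from \<open>h\<close> on. The last inner vertex must be
  adjacent to its predecessor and to \<open>x\<close>, hence the term \<open>2 * q\<close>.\<close>

lemma dense_path:
  assumes "finite C" and sym: "\<And>x y. F x y \<Longrightarrow> F y x"
    and q: "\<And>y. y \<in> C \<Longrightarrow> card {z \<in> C. z \<noteq> y \<and> \<not> F y z} \<le> q"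
    and "3 \<le> j" "h \<in> C - Z" "x \<in> C - Z" "h \<noteq> x" "2 * q + j + card (Z \<inter> C) \<le> card C"
  shows "\<exists>hs. distinct hs \<and> set hs \<subseteq> C - Z \<and> hs \<noteq> [] \<and> hd hs = h \<and> last hs = x \<and> length hs = j \<and> successively F hs"
  using assms(4-)
proof (induction j arbitrary: h Z rule: nat_induct_at_least)
  case base
  let ?D = "\<lambda>y. {z \<in> C. z \<noteq> y \<and> \<not> F y z}"
  have "card ({h, x} \<union> (Z \<inter> C) \<union> ?D h \<union> ?D x) \<le> card {h, x} + card (Z \<inter> C) + card (?D h) + card (?D x)"
    by (meson add_mono card_Un_le le_refl order_trans)
  also have "\<dots> \<le> 2 + card (Z \<inter> C) + q + q"
    using base q[of h] q[of x] by auto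
  also have "\<dots> < card C" using base by simp
  finally have "\<not> C \<subseteq> {h, x} \<union> (Z \<inter> C) \<union> ?D h \<union> ?D x"
    using card_mono[of "{h, x} \<union> (Z \<inter> C) \<union> ?D h \<union> ?D x" C] assms(1) by fastforce
  then obtain z where "z \<in> C - Z" "z \<noteq> h" "z \<noteq> x" "F h z" "F x z" by blast
  then show ?case using base sym by (intro exI[of _ "[h, z, x]"]) auto
next
  case (Suc j)
  let ?D = "{z \<in> C. z \<noteq> h \<and> \<not> F h z}"
  have "card ({h, x} \<union> (Z \<inter> C) \<union> ?D) \<le> card {h, x} + card (Z \<inter> C) + card ?D"
    by (meson add_mono card_Un_le le_refl order_trans)
  also have "\<dots> \<le> 2 + card (Z \<inter> C) + q"
    using Suc q[of h] by auto
  also have "\<dots> < card C" using Suc by simp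
  finally have "\<not> C \<subseteq> {h, x} \<union> (Z \<inter> C) \<union> ?D"
    using card_mono[of "{h, x} \<union> (Z \<inter> C) \<union> ?D" C] assms(1) by fastforce
  then obtain z where z: "z \<in> C - Z" "z \<noteq> h" "z \<noteq> x" "F h z" by blast
  have "insert h Z \<inter> C = insert h (Z \<inter> C)" "h \<notin> Z \<inter> C" using Suc by auto
  then have "card (insert h Z \<inter> C) = Suc (card (Z \<inter> C))" using assms(1) by simp
  then obtain hs where hs: "distinct hs" "set hs \<subseteq> C - insert h Z" "hs \<noteq> []" "hd hs = z" "last hs = x" "length hs = j" "successively F hs"
    using Suc.IH[of z "insert h Z"] Suc.prems z by auto
  then show ?case using Suc.prems z by (intro exI[of _ "h # hs"]) (auto simp: successively_Cons)
qed

section \<open>Complete bipartite blue graphs, red cycles of all lengths, and peeling\<close>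

context two_coloured
begin

lemma complete_bipartite_path:
  assumes "finite Y" "X \<inter> Y = {}" "\<And>x y. x \<in> X \<Longrightarrow> y \<in> Y \<Longrightarrow> B x y"
    and hs: "hs \<noteq> []" "distinct hs" "set hs \<subseteq> X" "card (Z \<inter> Y) + length hs \<le> card Y + 1"
  shows "\<exists>ps. ps \<noteq> [] \<and> distinct ps \<and> hd ps = hd hs \<and> last ps = last hs \<and> length ps + 1 = 2 * length hs \<and>
    successively B ps \<and> set ps \<subseteq> set hs \<union> (Y - Z)"
proof -
  have "{c \<in> Y. B x c \<and> B c y} = Y" if "x \<in> set hs" "y \<in> set hs" for x y
    using assms(3) hs(3) that B_sym by blast
  then have "successively (\<lambda>x y. card Y \<le> card {c \<in> Y. B x c \<and> B c y}) hs"
    using hs(2) by (intro successively_if_all) auto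
  then have "\<exists>ps. ps \<noteq> [] \<and> distinct ps \<and> hd ps = hd hs \<and> last ps = last hs \<and> length ps + 1 = 2 * length hs \<and>
    successively B ps \<and> set ps \<subseteq> set hs \<union> (Y - Z) \<and> card (set ps \<inter> Y) + 1 = length hs"
    using assms by (intro alternating_path[where d = "card Y"]) auto
  then show ?thesis by blast
qed

text \<open>An alternating path with \<open>m + 1\<close> vertices in \<open>X\<close> and
  \<open>m\<close> in \<open>Y\<close> would be closed by the inner edge to a blue cycle on
  \<open>2 * m + 1\<close> vertices.\<close>

lemma complete_bipartite_no_inner_edge:
  assumes "finite X" "finite Y" "X \<inter> Y = {}" "\<And>x y. x \<in> X \<Longrightarrow> y \<in> Y \<Longrightarrow> B x y"
    and "m < card X" "m < card Y" "x \<in> X" "x' \<in> X"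
  shows "\<not> B x x'"
proof
  assume b: "B x x'"
  then have ne: "x \<noteq> x'" using B_irrefl by blast
  have "card (X - {x, x'}) = card X - 2" using assms ne by (simp add: card_Diff_subset)
  then have "m - 1 \<le> card (X - {x, x'})" using \<open>m < card X\<close> by simp
  then obtain zs where zs: "distinct zs" "set zs \<subseteq> X - {x, x'}" "length zs = m - 1"
    using obtain_distinct_list[of "X - {x, x'}" "m - 1"] \<open>finite X\<close> by blast
  let ?hs = "x # zs @ [x']"
  have "\<exists>ps. ps \<noteq> [] \<and> distinct ps \<and> hd ps = hd ?hs \<and> last ps = last ?hs \<and> length ps + 1 = 2 * length ?hs \<and>
      successively B ps \<and> set ps \<subseteq> set ?hs \<union> (Y - {})"
    using assms zs ne by (intro complete_bipartite_path) auto
  then obtain ps where ps: "ps \<noteq> []" "distinct ps" "hd ps = x" "last ps = x'" "length ps + 1 = 2 * (m + 1)" "successively B ps"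
    using zs(3) m by auto
  then have "cyc B ps" using b B_sym m by (auto simp: cyc_def)
  then show False using no_blue ps(5) by fastforce
qed

text \<open>By the previous lemma \<open>w\<close> lies outside both sides. An alternating path from
  \<open>x\<close> to \<open>y\<close> on \<open>2 * m\<close> vertices would then be closed by
  \<open>w\<close>.\<close>

lemma complete_bipartite_no_common_neighbour:
  assumes XY: "finite X" "finite Y" "X \<inter> Y = {}" "\<And>x y. x \<in> X \<Longrightarrow> y \<in> Y \<Longrightarrow> B x y"
    and "m < card X" "m < card Y" "x \<in> X" "y \<in> Y" "B w x" "B w y"
  shows False
proof -
  have "w \<notin> X" using complete_bipartite_no_inner_edge[OF XY] assms by blast
  have "w \<notin> Y"
    using complete_bipartite_no_inner_edge[OF XY(2,1), of w y] assms B_sym by blast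
  have "m - 1 \<le> card (X - {x})" using assms by simp
  then obtain zs where zs: "distinct zs" "set zs \<subseteq> X - {x}" "length zs = m - 1"
    using obtain_distinct_list[of "X - {x}" "m - 1"] \<open>finite X\<close> by blast
  let ?hs = "x # zs"
  have "\<exists>ps. ps \<noteq> [] \<and> distinct ps \<and> hd ps = hd ?hs \<and> last ps = last ?hs \<and> length ps + 1 = 2 * length ?hs \<and>
      successively B ps \<and> set ps \<subseteq> set ?hs \<union> (Y - {y})"
    using assms zs by (intro complete_bipartite_path) auto
  then obtain ps where ps: "ps \<noteq> []" "distinct ps" "hd ps = x" "last ps = last ?hs" "length ps + 1 = 2 * m"
      "successively B ps" "set ps \<subseteq> set ?hs \<union> (Y - {y})"
    using zs(3) m by auto
  have sub: "set ?hs \<subseteq> X" using zs(2) \<open>x \<in> X\<close> by auto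
  have "last ?hs \<in> set ?hs" by (rule last_in_set) simp
  then have "B (last ps) y" using sub XY(4) \<open>y \<in> Y\<close> ps(4) by auto
  moreover have "y \<notin> set ps" using sub ps(7) XY(3) \<open>y \<in> Y\<close> by blast
  moreover have "w \<notin> set ps" using sub ps(7) \<open>w \<notin> X\<close> \<open>w \<notin> Y\<close> by blast
  moreover have "w \<noteq> y" using \<open>B w y\<close> B_irrefl by blast
  ultimately have "cyc B (w # ps @ [y])"
    using ps assms B_sym by (auto simp: cyc_def successively_append_iff successively_Cons hd_append Suc_le_eq)
  then show False using no_blue ps(5) by fastforce
qed

text \<open>A red path on \<open>l - 1\<close> vertices in the red neighbourhood of \<open>v\<close>
  is closed by \<open>v\<close>. If there is none, that neighbourhood contains large sets
  \<open>X\<close> and \<open>Y\<close> joined completely in blue. No vertex has blue neighbours in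
  both, so \<open>X\<close> or \<open>Y\<close> dominates, in red, a set of at least half of
  \<open>Q\<close>.\<close>

lemma short_cycles:
  assumes Q: "Q \<subseteq> V" "2 * n \<le> card Q + 3 * m + 1" and deg: "\<And>q. q \<in> Q \<Longrightarrow> n \<le> card {y \<in> Q. R q y} + 1"
    and l: "3 \<le> l" "l \<le> 6 * m"
  shows "\<exists>cs. cyc R cs \<and> length cs = l \<and> set cs \<subseteq> Q"
proof -
  have finQ: "finite Q" using Q finite_V finite_subset by blast
  have "card Q \<noteq> 0" using Q n by auto
  then obtain v where v: "v \<in> Q" by fastforce
  define M where "M = {y \<in> Q. R v y}"
  have M: "finite M" "n \<le> card M + 1" "M \<subseteq> Q" "v \<notin> M"
    using deg[OF v] finQ R_irrefl by (auto simp: M_def)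
  show ?thesis
  proof (cases "\<exists>ps. distinct ps \<and> set ps \<subseteq> M \<and> successively R ps \<and> l - 1 \<le> length ps")
    case True
    then obtain ps where ps: "distinct ps" "set ps \<subseteq> M" "successively R ps" "l - 1 \<le> length ps" by blast
    define qs where "qs = take (l - 1) ps"
    have qs: "distinct qs" "set qs \<subseteq> M" "length qs = l - 1"
      using ps set_take_subset[of "l - 1" ps] by (auto simp: qs_def)
    moreover have "successively R qs" using ps(3,4) by (auto simp: qs_def successively_conv_nth)
    moreover have "qs \<noteq> []" using qs(3) l by auto
    moreover have "hd qs \<in> M" "last qs \<in> M"
      using qs(2) \<open>qs \<noteq> []\<close> hd_in_set[of qs] last_in_set[of qs] by auto
    then have "R v (hd qs)" "R (last qs) v" using R_sym by (auto simp: M_def)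
    ultimately have "cyc R (v # qs)" using M(4) l by (auto simp: cyc_def successively_Cons)
    then show ?thesis using qs v M(3) l by (intro exI[of _ "v # qs"]) auto
  next
    case False
    then have no: "length ps < l - 1" if "distinct ps" "set ps \<subseteq> M" "successively R ps" for ps
      using that by (meson not_le)
    have "\<exists>X Y. X \<subseteq> M \<and> Y \<subseteq> M \<and> X \<inter> Y = {} \<and> card X = card Y \<and> card M + 1 \<le> 2 * card X + (l - 1) \<and>
      (\<forall>x\<in>X. \<forall>y\<in>Y. \<not> R x y)"
      using M(1) no by (rule disjoint_sets_without_edges)
    then obtain X Y where XY: "X \<subseteq> M" "Y \<subseteq> M" "X \<inter> Y = {}" "card X = card Y" "card M + 1 \<le> 2 * card X + (l - 1)"
      "\<forall>x\<in>X. \<forall>y\<in>Y. \<not> R x y"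
      by (elim exE conjE) (rule that)
    \<comment> \<open>\<open>2 * card X\<close> is at least \<open>n - (l - 1)\<close>, hence at
      least \<open>8 * m + 4\<close>.\<close>
    have c: "4 * m + 2 \<le> card X" using XY(5) M(2) l n by linarith
    have fin: "finite X" "finite Y" using XY M(1) finite_subset by blast+
    have XV: "X \<subseteq> V" "Y \<subseteq> V" using XY M(3) Q by blast+
    have blue: "B x y" if "x \<in> X" "y \<in> Y" for x y
    proof -
      have "x \<noteq> y" using that XY(3) by blast
      then show ?thesis using that XY(6) XV by (auto simp: R_def)
    qed
    have blue': "B y x" if "x \<in> X" "y \<in> Y" for x y using blue B_sym that by blast
    define Q1 where "Q1 = {w \<in> Q. \<forall>x\<in>X. \<not> B w x}"
    define Q2 where "Q2 = {w \<in> Q. \<forall>y\<in>Y. \<not> B w y}"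
    have "Q \<subseteq> Q1 \<union> Q2"
    proof
      fix w assume "w \<in> Q"
      then show "w \<in> Q1 \<union> Q2"
        using complete_bipartite_no_common_neighbour[OF fin XY(3) blue] c XY(4) m by (auto simp: Q1_def Q2_def)
    qed
    then have "card Q \<le> card (Q1 \<union> Q2)"
      using finQ by (intro card_mono) (auto simp: Q1_def Q2_def)
    then have "card Q \<le> card Q1 + card Q2" using card_Un_le[of Q1 Q2] by linarith
    then consider "6 * m \<le> card Q1" | "6 * m \<le> card Q2" using Q(2) n by linarith
    then show ?thesis
    proof cases
      case 1
      have "X \<subseteq> Q1"
        using complete_bipartite_no_inner_edge[OF fin XY(3) blue] c XY M(3) by (auto simp: Q1_def)
      moreover have "R x z" if "x \<in> X" "z \<in> Q1" "x \<noteq> z" for x z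
        using that XV Q B_sym by (auto simp: R_def Q1_def)
      ultimately have "\<exists>cs. cyc R cs \<and> length cs = l \<and> set cs \<subseteq> Q1"
        using 1 l c finQ R_sym by (intro cycle_in_dominated_set[where X = X]) (auto simp: Q1_def)
      then show ?thesis by (auto simp: Q1_def)
    next
      case 2
      have "Y \<inter> X = {}" using XY(3) by blast
      then have "Y \<subseteq> Q2"
        using complete_bipartite_no_inner_edge[OF fin(2,1) _ blue'] c XY M(3) by (auto simp: Q2_def)
      moreover have "R x z" if "x \<in> Y" "z \<in> Q2" "x \<noteq> z" for x z
        using that XV Q B_sym by (auto simp: R_def Q2_def)
      ultimately have "\<exists>cs. cyc R cs \<and> length cs = l \<and> set cs \<subseteq> Q2"
        using 2 l c XY(4) finQ R_sym by (intro cycle_in_dominated_set[where X = Y]) (auto simp: Q2_def)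
      then show ?thesis by (auto simp: Q2_def)
    qed
  qed
qed

text \<open>If \<open>l\<close> exceeds \<open>6 * m\<close>, take the least length of a red cycle
  in \<open>Q\<close> that is at least \<open>l\<close>. \<open>long_cycle\<close> shows that it
  exists, and \<open>shorten_cycle\<close> that it is \<open>l\<close>.\<close>

lemma all_cycles:
  assumes Q: "Q \<subseteq> V" "2 * n \<le> card Q + 3 * m + 1" and deg: "\<And>q. q \<in> Q \<Longrightarrow> n \<le> card {y \<in> Q. R q y} + 1"
    and l: "3 \<le> l" "l \<le> n"
  shows "\<exists>cs. cyc R cs \<and> length cs = l \<and> set cs \<subseteq> Q"
proof (cases "l \<le> 6 * m")
  case True
  then show ?thesis using short_cycles[OF Q deg] l by blast
next
  case False
  define C where "C L \<longleftrightarrow> l \<le> L \<and> (\<exists>cs. cyc R cs \<and> length cs = L \<and> set cs \<subseteq> Q)" for L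
  have "finite Q" using Q finite_V finite_subset by blast
  moreover have "Q \<noteq> {}" using Q n by auto
  ultimately obtain cs where "cyc R cs" "set cs \<subseteq> Q" "n - 1 + 1 \<le> length cs"
    using long_cycle[of Q "n - 1" R] deg R_sym R_irrefl n m by fastforce
  then have "C (length cs)" using l by (auto simp: C_def)
  then have min: "C (Least C)" "\<And>L. C L \<Longrightarrow> Least C \<le> L" by (auto intro: LeastI Least_le)
  then obtain cs where cs: "cyc R cs" "length cs = Least C" "set cs \<subseteq> Q" "l \<le> Least C" by (auto simp: C_def)
  have "\<not> l < Least C"
  proof
    assume "l < Least C"
    then obtain ys where "cyc R ys" "set ys \<subseteq> set cs" "length ys + 1 = length cs"
      using shorten_cycle[OF cs(1)] cs(2) False by auto
    then have "C (Least C - 1)" using cs \<open>l < Least C\<close> by (auto simp: C_def intro!: exI[of _ ys])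
    then show False using min(2) \<open>l < Least C\<close> by fastforce
  qed
  then show ?thesis using cs by auto
qed

text \<open>A vertex removed as number \<open>p\<close> leaves \<open>2 * n - 1 - p\<close> others,
  of which at most \<open>n - 2\<close> are red neighbours; so at least \<open>n + 1 - p\<close> are
  blue ones. Each removal costs the earlier members of \<open>P\<close> at most one blue neighbour,
  which the growing \<open>p\<close> absorbs.\<close>

lemma peel:
  "(\<exists>Q\<subseteq>V. 2 * n \<le> card Q + p \<and> (\<forall>q\<in>Q. n \<le> card {y \<in> Q. R q y} + 1)) \<or>
   (\<exists>P\<subseteq>V. card P = p \<and> (\<forall>x\<in>P. n + 1 \<le> card {y \<in> V - P. B x y} + p))"
proof (induction p)
  case (Suc p)
  then show ?case
  proof
    assume "\<exists>P\<subseteq>V. card P = p \<and> (\<forall>x\<in>P. n + 1 \<le> card {y \<in> V - P. B x y} + p)"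
    then obtain P where P: "P \<subseteq> V" "card P = p" "\<forall>x\<in>P. n + 1 \<le> card {y \<in> V - P. B x y} + p" by blast
    define Q where "Q = V - P"
    have finP: "finite P" and finQ: "finite Q" using P finite_V by (auto simp: Q_def intro: finite_subset)
    have cQ: "card Q + p + 1 = 2 * n"
      using P finP card_V card_mono[OF finite_V P(1)] by (simp add: Q_def card_Diff_subset)
    show ?case
    proof (cases "\<forall>q\<in>Q. n \<le> card {y \<in> Q. R q y} + 1")
      case True
      then show ?thesis using cQ by (intro disjI1 exI[of _ Q]) (auto simp: Q_def)
    next
      case False
      then obtain y where y: "y \<in> Q" "card {z \<in> Q. R y z} + 1 < n" by auto
      let ?P = "insert y P"
      have "Q = insert y ({z \<in> Q. R y z} \<union> {z \<in> V - ?P. B y z})"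
        using y(1) B_irrefl B_V2 by (auto simp: Q_def R_def)
      then have "card Q \<le> Suc (card ({z \<in> Q. R y z} \<union> {z \<in> V - ?P. B y z}))"
        using card_insert_le_Suc by metis
      also have "\<dots> \<le> Suc (card {z \<in> Q. R y z} + card {z \<in> V - ?P. B y z})"
        by (simp add: card_Un_le)
      finally have dy: "n + 1 \<le> card {z \<in> V - ?P. B y z} + Suc p" using y(2) cQ by linarith
      have bx: "n + 1 \<le> card {z \<in> V - ?P. B x z} + Suc p" if "x \<in> P" for x
      proof -
        have "{z \<in> V - P. B x z} \<subseteq> insert y {z \<in> V - ?P. B x z}" by auto
        then have "card {z \<in> V - P. B x z} \<le> card (insert y {z \<in> V - ?P. B x z})"
          using finite_V by (intro card_mono) auto
        then have "card {z \<in> V - P. B x z} \<le> Suc (card {z \<in> V - ?P. B x z})"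
          by (rule order_trans[OF _ card_insert_le_Suc])
        moreover have "n + 1 \<le> card {z \<in> V - P. B x z} + p" using P(3) that by blast
        ultimately show ?thesis by linarith
      qed
      have "?P \<subseteq> V" "card ?P = Suc p" using P y(1) finP by (auto simp: Q_def)
      then show ?thesis using dy bx by (intro disjI2 exI[of _ ?P]) auto
    qed
  qed auto
qed auto

end

subsection \<open>Vertices of large blue degree\<close>

locale host = two_coloured V B m n + unicyclic T u v
  for V :: "'v set" and B m n and T :: "'a sgraph" and u v +
  assumes card_W: "card W = n"
begin

text \<open>\<open>F\<close> joins hubs with many common blue neighbours, and \<open>q\<close>
  bounds the number of hubs of \<open>C\<close> not joined to a given one. From each vertex of
  \<open>K\<close> a blue path leads through another hub to \<open>x\<close>, and \<open>x\<close>
  is also a direct blue neighbour; this makes blue edges near \<open>K\<close> close up to forbidden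
  cycles.\<close>

lemma embeds_if_hub:
  assumes m2: "2 \<le> m" and P: "P \<subseteq> V" and U: "U = V - P"
    and F: "\<And>x y. F x y \<longleftrightarrow> m + 2 \<le> card {c \<in> U. B x c \<and> B c y}"
    and C: "C \<subseteq> P" "2 * q + m + 1 \<le> card C"
    and q: "\<And>y. y \<in> C \<Longrightarrow> card {z \<in> C. z \<noteq> y \<and> \<not> F y z} \<le> q"
    and x: "x \<in> C" and K: "K = {a \<in> U. B x a \<and> (\<exists>h\<in>C. h \<noteq> x \<and> F h x \<and> B h a)}"
    and big: "n + 4 \<le> 2 * card K"
  shows "embeds R V"
proof -
  have F_sym: "F y z" if "F z y" for y z
  proof -
    have "{c \<in> U. B y c \<and> B c z} = {c \<in> U. B z c \<and> B c y}" using B_sym by blast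
    then show ?thesis using that F by simp
  qed
  have finU: "finite U" and finC: "finite C" and UC: "U \<inter> C = {}" and CV: "C \<subseteq> V"
    using finite_V P U C(1) by (auto intro: finite_subset)
  \<comment> \<open>A path of \<open>j\<close> hubs in \<open>F\<close> is refined by common blue
    neighbours. The bounds on \<open>X\<close> reflect the \<open>m + 1\<close> spare hubs of
    \<open>C\<close> and the \<open>m + 2\<close> common neighbours.\<close>
  have link: "\<exists>ps. ps \<noteq> [] \<and> distinct ps \<and> hd ps = h \<and> last ps = x \<and> length ps + 1 = 2 * j \<and>
      successively B ps \<and> set ps \<subseteq> C \<union> U - X"
    if h: "h \<in> C" "h \<noteq> x" "F h x" and j: "2 \<le> j" and X: "h \<notin> X" "x \<notin> X"
      "j + card (X \<inter> C) \<le> m + 1" "j + card (X \<inter> U) \<le> m + 3" for h j X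
  proof -
    have "\<exists>hs. distinct hs \<and> set hs \<subseteq> C - X \<and> hs \<noteq> [] \<and> hd hs = h \<and> last hs = x \<and> length hs = j \<and> successively F hs"
    proof (cases "j = 2")
      case True
      then show ?thesis using h x X by (intro exI[of _ "[h, x]"]) auto
    next
      case False
      then show ?thesis
        using h x X j C(2) by (intro dense_path[OF finC F_sym q]) auto
    qed
    then obtain hs where hs: "distinct hs" "set hs \<subseteq> C - X" "hs \<noteq> []" "hd hs = h" "last hs = x" "length hs = j" "successively F hs"
      by blast
    have "successively (\<lambda>y z. m + 2 \<le> card {c \<in> U. B y c \<and> B c z}) hs"
      using hs(7) F by (simp cong: successively_cong)
    then have "\<exists>ps. ps \<noteq> [] \<and> distinct ps \<and> hd ps = hd hs \<and> last ps = last hs \<and> length ps + 1 = 2 * length hs \<and>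
        successively B ps \<and> set ps \<subseteq> set hs \<union> (U - X) \<and> card (set ps \<inter> U) + 1 = length hs"
      using hs UC X finU by (intro alternating_path[where d = "m + 2"]) auto
    then obtain ps where ps: "ps \<noteq> []" "distinct ps" "hd ps = hd hs" "last ps = last hs" "length ps + 1 = 2 * length hs"
      "successively B ps" "set ps \<subseteq> set hs \<union> (U - X)" by blast
    then show ?thesis using hs by (intro exI[of _ ps]) auto
  qed
  \<comment> \<open>the blue cycle \<open>s, t, h, \<dots>, x\<close>\<close>
  have close: False
    if h: "h \<in> C" "h \<noteq> x" "F h x" and b: "B s t" "B t h" "B x s" "s \<noteq> h" "t \<noteq> x" and nC: "s \<notin> C \<or> t \<notin> C" for h s t
  proof -
    have ne: "t \<noteq> h" "s \<noteq> x" "s \<noteq> t" using b B_irrefl by blast+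
    have "card ({s, t} \<inter> C) \<le> 1"
    proof -
      have "{s, t} \<inter> C \<subseteq> {s} \<or> {s, t} \<inter> C \<subseteq> {t}" using nC by blast
      then show ?thesis using card_mono[of "{s}" "{s, t} \<inter> C"] card_mono[of "{t}" "{s, t} \<inter> C"] by auto
    qed
    moreover have "card ({s, t} \<inter> U) \<le> 2"
      using card_mono[of "{s, t}" "{s, t} \<inter> U"] ne by simp
    ultimately obtain ps where ps: "ps \<noteq> []" "distinct ps" "hd ps = h" "last ps = x" "length ps + 1 = 2 * m"
      "successively B ps" "set ps \<subseteq> C \<union> U - {s, t}"
      using link[OF h m2, of "{s, t}"] ne b by auto
    have "cyc B (s # t # ps)"
      using ps b ne m2 by (auto simp: cyc_def successively_Cons)
    then show False using no_blue ps(5) by fastforce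
  qed
  have Kx: "B x a" "a \<in> U" "a \<notin> C" "a \<in> V" if "a \<in> K" for a
    using that UC U by (auto simp: K)
  have Kh: "\<exists>h\<in>C. h \<noteq> x \<and> F h x \<and> B a h" if "a \<in> K" for a
    using that B_sym by (auto simp: K)
  \<comment> \<open>Otherwise \<open>a', a, h, ..., x\<close> is a blue cycle. Here
    \<open>a'\<close> may be any blue neighbour of \<open>x\<close> in \<open>U\<close>, inside
    \<open>K\<close> or not.\<close>
  have KN: "\<not> B a a'" if aa: "a \<in> K" "a' \<in> U" "B x a'" for a a'
  proof
    assume "B a a'"
    obtain h where "h \<in> C" "h \<noteq> x" "F h x" "B a h" using Kh aa(1) by blast
    then show False
      using close[of h a' a] aa \<open>B a a'\<close> Kx[of a] UC x B_sym by blast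
  qed
  define B2 where "B2 = {b \<in> V. 2 \<le> card {k \<in> K. B b k}}"
  have B2_clique: "\<not> B b b'" if b: "b \<in> B2" "b' \<in> B2" for b b'
  proof
    assume bb: "B b b'"
    have nbr: "\<exists>a\<in>K. B b a \<and> a \<noteq> y" if "b \<in> B2" for b y
      using ex_other_element[of "{k \<in> K. B b k}" y] that by (auto simp: B2_def)
    have notU: "\<not> (b \<in> U \<and> B x b)" if "b \<in> B2" for b
      using nbr[OF that] KN B_sym by blast
    \<comment> \<open>If \<open>c\<close> is a hub joined to \<open>x\<close> by \<open>F\<close>, a
      blue path on \<open>2 * m + 1\<close> vertices leads from \<open>c\<close> to
      \<open>x\<close>; otherwise the cycle is \<open>c, a, h, ..., x\<close>.\<close>
    have x_case: False if xc: "B x c" "c \<in> B2" for c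
    proof -
      have "c \<noteq> x" using xc B_irrefl by blast
      obtain a where a: "a \<in> K" "B c a" using nbr xc(2) by blast
      show False
      proof (cases "c \<in> C \<and> F c x")
        case True
        then obtain ps where ps: "ps \<noteq> []" "distinct ps" "hd ps = c" "last ps = x" "length ps + 1 = 2 * (m + 1)" "successively B ps"
          using link[of c "m + 1" "{}"] \<open>c \<noteq> x\<close> m2 by auto
        then have "cyc B ps" using xc m2 by (auto simp: cyc_def)
        then show False using no_blue ps(5) by fastforce
      next
        case False
        obtain h where h: "h \<in> C" "h \<noteq> x" "F h x" "B a h" using Kh a by blast
        then show False using close[of h c a] a xc False Kx[of a] UC x by blast
      qed
    qed
    \<comment> \<open>Here the cycle is \<open>a, c', c, ..., x\<close>.\<close>
    have hub_case: False if c: "c \<in> C" "F c x" "c \<noteq> x" "c' \<noteq> x" "B c c'" "c' \<in> B2" for c c'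
    proof -
      obtain a where a: "a \<in> K" "B c' a" using nbr c(6) by blast
      then show False using close[of c a c'] c Kx[of a] B_sym by blast
    qed
    show False
    proof (cases "b = x \<or> b' = x \<or> (b \<in> C \<and> F b x) \<or> (b' \<in> C \<and> F b' x)")
      case True
      then show ?thesis using x_case hub_case bb b B_sym by metis
    next
      case False
      \<comment> \<open>The cycle will be \<open>a', b', b, a\<close> followed by \<open>ps\<close>.
        It needs \<open>a\<close> and \<open>a'\<close> to be different, which is why
        \<open>B2\<close> asks for two blue neighbours in \<open>K\<close>.\<close>
      obtain a' where a': "a' \<in> K" "B b' a'" using nbr b by blast
      obtain a where a: "a \<in> K" "B b a" "a \<noteq> a'" using nbr b by blast
      have notK: "b \<notin> K" "b' \<notin> K" using notU b Kx by blast+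
      have ne: "b \<noteq> b'" "a \<noteq> b" "a \<noteq> b'" "a' \<noteq> b" "a' \<noteq> b'" "x \<noteq> a" "x \<noteq> a'" "b \<noteq> x" "b' \<noteq> x"
        using bb B_irrefl a a' notK Kx False by blast+
      have "\<exists>ps. ps \<noteq> [] \<and> distinct ps \<and> B a (hd ps) \<and> last ps = x \<and> length ps + 3 = 2 * m \<and>
          successively B ps \<and> set ps \<inter> {a, a', b, b'} = {}"
      \<comment> \<open>For \<open>m = 2\<close> the path \<open>ps\<close> has a single vertex, so
        \<open>a\<close> is followed by \<open>x\<close> directly and not by another hub.\<close>
      proof (cases "m = 2")
        case True
        then show ?thesis using ne Kx(1)[OF a(1)] B_sym by (intro exI[of _ "[x]"]) auto
      next
        case False
        obtain h where h: "h \<in> C" "h \<noteq> x" "F h x" "B a h" using Kh a by blast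
        have hne: "h \<notin> {a, a', b, b'}" "x \<notin> {a, a', b, b'}"
          using h a a' Kx ne \<open>\<not> (b = x \<or> b' = x \<or> (b \<in> C \<and> F b x) \<or> (b' \<in> C \<and> F b' x))\<close> by blast+
        have "card ({a, a', b, b'} \<inter> C) \<le> card {b, b'}"
          using Kx a a' by (intro card_mono) auto
        then have "card ({a, a', b, b'} \<inter> C) \<le> 2" using ne by simp
        moreover have "card ({a, a', b, b'} \<inter> U) \<le> 4"
        proof -
          have "card ({a, a', b, b'} \<inter> U) \<le> card {a, a', b, b'}" by (intro card_mono) auto
          also have "\<dots> \<le> 4" by (simp add: card_insert_if)
          finally show ?thesis .
        qed
        ultimately have "2 \<le> m - 1" "m - 1 + card ({a, a', b, b'} \<inter> C) \<le> m + 1"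
          "m - 1 + card ({a, a', b, b'} \<inter> U) \<le> m + 3"
          using m2 False by linarith+
        then obtain ps where ps: "ps \<noteq> []" "distinct ps" "hd ps = h" "last ps = x" "length ps + 1 = 2 * (m - 1)"
          "successively B ps" "set ps \<subseteq> C \<union> U - {a, a', b, b'}"
          using link[OF h(1,2,3), of "m - 1" "{a, a', b, b'}"] hne by blast
        then show ?thesis using h m2 by (intro exI[of _ ps]) auto
      qed
      then obtain ps where ps: "ps \<noteq> []" "distinct ps" "B a (hd ps)" "last ps = x" "length ps + 3 = 2 * m"
        "successively B ps" "set ps \<inter> {a, a', b, b'} = {}" by blast
      have "B a' b'" "B b' b" "B x a'" using a' bb B_sym Kx by blast+
      then have "cyc B (a' # b' # b # a # ps)"
        using ps a ne by (auto simp: cyc_def successively_Cons)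
      then show False using no_blue ps(5) by fastforce
    qed
  qed
  have B2: "B2 \<subseteq> V" "finite B2" using finite_V by (auto simp: B2_def)
  show ?thesis
  proof (cases "n \<le> card B2")
    case True
    then have "embeds R B2"
      using B2 B2_clique card_W by (intro embeds_clique) (auto simp: R_def)
    then show ?thesis using B2(1) by (rule embeds_mono)
  next
    case False
    have KV: "K \<subseteq> V - B2"
    proof
      fix k assume k: "k \<in> K"
      then have "{k' \<in> K. B k k'} = {}" using KN Kx by blast
      then have "card {k' \<in> K. B k k'} = 0" by (simp only: card.empty)
      then show "k \<in> V - B2" using Kx k by (simp add: B2_def)
    qed
    \<comment> \<open>With at most \<open>n - 1\<close> vertices in \<open>B2\<close>, at least
      \<open>n\<close> of the \<open>2 * n - 1\<close> remain, and each of them has at most one blue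
      neighbour in \<open>K\<close>.\<close>
    have "card (V - B2) = card V - card B2" using B2 by (simp add: card_Diff_subset)
    then have cY: "card W \<le> card (V - B2)" using False card_V card_W by simp
    have "embeds R (V - B2)"
    proof (rule embeds_near_dominating[OF _ cY KV])
      show "card W + 4 \<le> 2 * card K" using big card_W by simp
      show "R y z" if "y \<in> K" "z \<in> K" "y \<noteq> z" for y z
        using that KN Kx by (auto simp: R_def)
      show "card {k \<in> K. \<not> R y k} \<le> 1" if "y \<in> V - B2 - K" for y
      proof -
        have "{k \<in> K. \<not> R y k} = {k \<in> K. B y k}" using that Kx by (auto simp: R_def)
        moreover have "\<not> 2 \<le> card {k \<in> K. B y k}" using that by (simp add: B2_def)
        ultimately show ?thesis by simp
      qed
    qed (use finite_V R_sym in auto)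
    then show ?thesis by (rule embeds_mono) auto
  qed
qed

end

section \<open>Existence of a suitable hub, and the upper bound\<close>

context host
begin

text \<open>
  If many hubs are non-adjacent to \<open>y\<close> with respect to \<open>F\<close>, their blue neighbourhoods almost fill the
  complement of that of \<open>y\<close> and thus overlap pairwise. Otherwise \<open>F\<close> is dense on all hubs; if two of
  them are non-adjacent, their neighbourhoods almost cover \<open>U\<close>, and if there are none, some hub has
  few private neighbours by averaging.
\<close>

lemma embeds_if_many_hubs:
  assumes m2: "2 \<le> m" and P: "P \<subseteq> V" "card P = 3 * m + 1"
    and deg: "\<And>x. x \<in> P \<Longrightarrow> n + 1 \<le> card {y \<in> V - P. B x y} + (3 * m + 1)"
  shows "embeds R V"
proof -
  define U where "U = V - P"
  define N where "N x = {c \<in> U. B x c}" for x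
  define F where "F x y \<longleftrightarrow> m + 2 \<le> card {c \<in> U. B x c \<and> B c y}" for x y
  define D where "D y = {z \<in> P. z \<noteq> y \<and> \<not> F y z}" for y
  have finP: "finite P" and finU: "finite U" using P finite_V by (auto simp: U_def intro: finite_subset)
  have finN: "finite (N x)" for x using finU by (simp add: N_def)
  have NU: "N x \<subseteq> U" for x by (auto simp: N_def)
  have cU: "card U + 3 * m + 2 = 2 * n"
  proof -
    have "card U = card V - card P" using P(1) finP by (simp add: U_def card_Diff_subset)
    moreover have "card P \<le> card V" using P(1) finite_V by (rule card_mono[rotated])
    ultimately show ?thesis using P(2) card_V by linarith
  qed
  have cN: "n \<le> card (N x) + 3 * m" if "x \<in> P" for x
    using deg[OF that] by (simp add: N_def U_def)
  have common: "{c \<in> U. B x c \<and> B c y} = N x \<inter> N y" for x y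
    using B_sym by (auto simp: N_def)
  have F_iff: "F x y \<longleftrightarrow> m + 2 \<le> card (N x \<inter> N y)" for x y
    by (simp only: F_def common)
  have co: "card (U - N y) + 2 \<le> n" if "y \<in> P" for y
  proof -
    have "card U = card (U - N y) + card (N y)"
      using card_Diff_subset[OF finN NU] card_mono[OF finU NU] by (metis le_add_diff_inverse2)
    then show ?thesis using cU cN[OF that] by linarith
  qed
  have hub: "embeds R V" if "C \<subseteq> P" "2 * q + m + 1 \<le> card C"
    "\<And>y. y \<in> C \<Longrightarrow> card {z \<in> C. z \<noteq> y \<and> \<not> F y z} \<le> q" "x \<in> C"
    "n + 4 \<le> 2 * card {a \<in> U. B x a \<and> (\<exists>h\<in>C. h \<noteq> x \<and> F h x \<and> B h a)}" for C q x
    using that by (intro embeds_if_hub[OF m2 P(1) U_def F_def that(1-4) refl that(5)])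
  show ?thesis
  proof (cases "\<exists>y\<in>P. m + 1 \<le> card (D y)")
    case True
    then obtain y where y: "y \<in> P" "m + 1 \<le> card (D y)" by blast
    \<comment> \<open>Each \<open>M z\<close> has at least \<open>n - 4 * m - 1\<close> elements and
      lies in \<open>U - N y\<close>, which has at most \<open>n - 2\<close>. Two of them share at
      least \<open>n - 8 * m\<close>, enough for \<open>F\<close>.\<close>
    define M where "M z = N z - N y" for z
    have finM: "finite (M z)" for z using finN by (simp add: M_def)
    have MU: "M z \<subseteq> U - N y" for z using NU by (auto simp: M_def)
    have cM: "n \<le> card (M z) + 4 * m + 1" if "z \<in> D y" for z
    proof -
      have "card (N z) = card (M z) + card (N y \<inter> N z)"
        using finN by (metis M_def Int_commute card_Diff_subset_Int card_mono finite_Int inf_le1 le_add_diff_inverse2)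
      moreover have "card (N y \<inter> N z) \<le> m + 1" using that by (auto simp: D_def F_iff)
      moreover have "n \<le> card (N z) + 3 * m" using cN that by (auto simp: D_def)
      ultimately show ?thesis by linarith
    qed
    have D_clique: "F z z'" if "z \<in> D y" "z' \<in> D y" for z z'
    proof -
      have "card (M z) + card (M z') = card (M z \<union> M z') + card (M z \<inter> M z')"
        using finM by (intro card_Un_Int)
      moreover have "card (M z \<union> M z') \<le> card (U - N y)"
        using MU finU by (intro card_mono) auto
      moreover have "card (M z \<inter> M z') \<le> card (N z \<inter> N z')"
        using finN by (intro card_mono) (auto simp: M_def)
      ultimately show ?thesis
        using cM[OF that(1)] cM[OF that(2)] co[OF y(1)] n unfolding F_iff by linarith
    qed
    have DP: "D y \<subseteq> P" by (auto simp: D_def)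
    have "finite (D y)" using DP finP by (rule finite_subset)
    moreover have "3 \<le> card (D y)" using y m2 by linarith
    ultimately obtain zs where "distinct zs" "set zs \<subseteq> D y" "length zs = 3"
      using obtain_distinct_list by blast
    then obtain z1 z2 z3 where z: "z1 \<in> D y" "z2 \<in> D y" "z3 \<in> D y" "z1 \<noteq> z2" "z1 \<noteq> z3" "z2 \<noteq> z3"
      by (auto simp: length_Suc_conv numeral_3_eq_3)
    have step: "embeds R V" if a: "a \<in> D y" "b \<in> D y" "c \<in> D y" "a \<noteq> b" "a \<noteq> c" and small: "2 * card (M a - (M b \<union> M c)) + 1 \<le> 4 * m" for a b c
    proof -
      let ?K = "{d \<in> U. B a d \<and> (\<exists>h\<in>D y. h \<noteq> a \<and> F h a \<and> B h d)}"
      have "M a \<subseteq> ?K \<union> (M a - (M b \<union> M c))"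
        using a D_clique[of b a] D_clique[of c a] by (auto simp: M_def N_def)
      then have "card (M a) \<le> card (?K \<union> (M a - (M b \<union> M c)))"
        using finU finM by (intro card_mono) auto
      then have "card (M a) \<le> card ?K + card (M a - (M b \<union> M c))"
        using card_Un_le[of ?K] by (meson le_trans)
      then have "n + 4 \<le> 2 * card ?K" using cM[OF a(1)] small n m2 by linarith
      moreover have "card {z \<in> D y. z \<noteq> z' \<and> \<not> F z' z} \<le> 0" if "z' \<in> D y" for z'
        using D_clique that by (simp add: card_eq_0_iff)
      ultimately show ?thesis using DP a(1) y(2) by (intro hub[of "D y" 0 a]) auto
    qed
    \<comment> \<open>The private parts of \<open>M z1\<close> and \<open>M z2\<close> are disjoint
      and avoid \<open>M z3\<close>, so together they have at most \<open>4 * m - 1\<close> elements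
      and the smaller one suits \<open>step\<close>.\<close>
    have "card (M z1 - (M z2 \<union> M z3)) + card (M z2 - (M z1 \<union> M z3)) = card ((M z1 - (M z2 \<union> M z3)) \<union> (M z2 - (M z1 \<union> M z3)))"
      using finM by (intro card_Un_disjoint[symmetric]) auto
    also have "\<dots> \<le> card (U - N y - M z3)"
      using finU MU by (intro card_mono) auto
    also have "\<dots> = card (U - N y) - card (M z3)"
      using MU finM by (intro card_Diff_subset)
    finally have "card (M z1 - (M z2 \<union> M z3)) + card (M z2 - (M z1 \<union> M z3)) + 1 \<le> 4 * m"
      using cM[OF z(3)] co[OF y(1)] m2 by linarith
    then have "2 * card (M z1 - (M z2 \<union> M z3)) + 1 \<le> 4 * m \<or> 2 * card (M z2 - (M z1 \<union> M z3)) + 1 \<le> 4 * m"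
      by linarith
    then show ?thesis using step[of z1 z2 z3] step[of z2 z1 z3] z by blast
  next
    case False
    then have Dm: "card (D y) \<le> m" if "y \<in> P" for y using that by force
    \<comment> \<open>With \<open>C = P\<close> and \<open>q = m\<close> the size condition reads
      \<open>3 * m + 1\<close>, the number of hubs.\<close>
    have hubP: "embeds R V" if "x \<in> P" "n + 4 \<le> 2 * card {a \<in> U. B x a \<and> (\<exists>h\<in>P. h \<noteq> x \<and> F h x \<and> B h a)}" for x
      using hub[of P m x] Dm that P(2) by (simp add: D_def)
    show ?thesis
    proof (cases "\<exists>x\<in>P. \<exists>y\<in>P. x \<noteq> y \<and> \<not> F x y")
      case True
      then obtain x y where xy: "x \<in> P" "y \<in> P" "x \<noteq> y" "\<not> F x y" by blast
      have "card ({x, y} \<union> D x \<union> D y) \<le> card {x, y} + card (D x) + card (D y)"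
        by (meson add_mono card_Un_le le_refl order_trans)
      also have "\<dots> < card P" using Dm[OF xy(1)] Dm[OF xy(2)] P(2) xy(3) m2 by simp
      finally have "\<not> P \<subseteq> {x, y} \<union> D x \<union> D y"
        using card_mono[of "{x, y} \<union> D x \<union> D y" P] finP by (fastforce simp: D_def)
      then obtain z where z: "z \<in> P" "z \<noteq> x" "z \<noteq> y" "F x z" "F y z" by (auto simp: D_def)
      let ?K = "{a \<in> U. B z a \<and> (\<exists>h\<in>P. h \<noteq> z \<and> F h z \<and> B h a)}"
      \<comment> \<open>\<open>N x\<close> and \<open>N y\<close> share at most \<open>m + 1\<close>
        vertices, so at most \<open>4 * m - 1\<close> vertices of \<open>U\<close> are outside both;
        the hub \<open>z\<close> loses only these.\<close>
      have "N z \<subseteq> ?K \<union> (U - (N x \<union> N y))"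
        using z xy by (auto simp: N_def)
      then have "card (N z) \<le> card (?K \<union> (U - (N x \<union> N y)))"
        using finU by (intro card_mono) auto
      then have "card (N z) \<le> card ?K + card (U - (N x \<union> N y))"
        using card_Un_le[of ?K] by (meson le_trans)
      moreover have "card (U - (N x \<union> N y)) = card U - card (N x \<union> N y)"
        using NU finN by (intro card_Diff_subset) auto
      moreover have "card (N x) + card (N y) = card (N x \<union> N y) + card (N x \<inter> N y)"
        using finN by (intro card_Un_Int)
      moreover have "card (N x \<inter> N y) \<le> m + 1" using xy(4) by (simp add: F_iff)
      ultimately have "n + 4 \<le> 2 * card ?K"
        using cN[OF z(1)] cN[OF xy(1)] cN[OF xy(2)] cU n m2 by linarith
      then show ?thesis using hubP z(1) by blast
    next
      case False
      then have Fall: "F x y" if "x \<in> P" "y \<in> P" "x \<noteq> y" for x y using that by blast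
      \<comment> \<open>These private neighbourhoods are disjoint. Setting one hub \<open>j\<close>
        aside confines the others to \<open>U - N j\<close>, with at most \<open>n - 2\<close>
        vertices, while at least six of them remain because \<open>m\<close> is at least 2.\<close>
      define p where "p i = N i - (\<Union>h\<in>P - {i}. N h)" for i
      have finp: "finite (p i)" for i using finN by (simp add: p_def)
      obtain j where j: "j \<in> P" using P(2) by fastforce
      have "\<exists>i\<in>P - {j}. 2 * card (p i) + 6 * m + 4 \<le> n"
      proof (rule ccontr)
        assume "\<not> ?thesis"
        then have large: "n - (6 * m + 3) \<le> 2 * card (p i)" if "i \<in> P - {j}" for i using that by force
        have "6 * (n - (6 * m + 3)) \<le> card (P - {j}) * (n - (6 * m + 3))"
          using P(2) j m2 by (intro mult_right_mono) auto
        also have "\<dots> \<le> (\<Sum>i\<in>P - {j}. 2 * card (p i))"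
          using sum_bounded_below[of "P - {j}" "n - (6 * m + 3)" "\<lambda>i. 2 * card (p i)"] large by simp
        also have "\<dots> = 2 * (\<Sum>i\<in>P - {j}. card (p i))" by (simp add: sum_distrib_left)
        also have "(\<Sum>i\<in>P - {j}. card (p i)) = card (\<Union>i\<in>P - {j}. p i)"
          using finP finp by (intro card_UN_disjoint[symmetric]) (auto simp: p_def)
        also have "card (\<Union>i\<in>P - {j}. p i) \<le> card (U - N j)"
          using finU NU j by (intro card_mono) (auto simp: p_def)
        finally show False using co[OF j] n m2 by linarith
      qed
      then obtain i where i: "i \<in> P" "2 * card (p i) + 6 * m + 4 \<le> n" by blast
      let ?K = "{a \<in> U. B i a \<and> (\<exists>h\<in>P. h \<noteq> i \<and> F h i \<and> B h a)}"
      have "N i \<subseteq> ?K \<union> p i"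
        using Fall i(1) by (auto simp: N_def p_def)
      then have "card (N i) \<le> card (?K \<union> p i)"
        using finU finp by (intro card_mono) auto
      then have "card (N i) \<le> card ?K + card (p i)"
        using card_Un_le[of ?K] by (meson le_trans)
      then have "n + 4 \<le> 2 * card ?K" using cN[OF i(1)] i(2) by linarith
      then show ?thesis using hubP i(1) by blast
    qed
  qed
qed

text \<open>For triangles a single hub suffices: its blue neighbourhood has at least
  \<open>n\<close> vertices and is a red clique. For larger \<open>m\<close> peeling is continued up
  to \<open>3 * m + 1\<close> hubs.\<close>

theorem embeds_red: "embeds R V"
proof -
  have core: "embeds R V" if Q: "Q \<subseteq> V" "2 * n \<le> card Q + 3 * m + 1" "\<forall>q\<in>Q. n \<le> card {y \<in> Q. R q y} + 1" for Q
  proof -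
    have "embeds R Q"
    proof (rule embeds_min_degree)
      show "finite Q" using Q(1) finite_V by (rule finite_subset)
      show "\<exists>cs. cyc R cs \<and> length cs = l \<and> set cs \<subseteq> Q" if "3 \<le> l" "l \<le> card W" for l
        using all_cycles[of Q l] Q that card_W by blast
    qed (use Q(3) card_W R_sym R_irrefl in auto)
    then show ?thesis using Q(1) by (rule embeds_mono)
  qed
  show ?thesis
  proof (cases "m = 1")
    case True
    from peel[of 1] show ?thesis
    proof
      assume "\<exists>P\<subseteq>V. card P = 1 \<and> (\<forall>x\<in>P. n + 1 \<le> card {y \<in> V - P. B x y} + 1)"
      then obtain P where P: "P \<subseteq> V" "card P = 1" "\<forall>x\<in>P. n + 1 \<le> card {y \<in> V - P. B x y} + 1" by blast
      then obtain x where x: "P = {x}" by (auto simp: card_1_singleton_iff)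
      let ?A = "{y \<in> V - P. B x y}"
      have clique: "\<not> B y z" if yz: "y \<in> ?A" "z \<in> ?A" "y \<noteq> z" for y z
      proof
        assume "B y z"
        then have "cyc B [x, y, z]" using yz x B_sym B_irrefl by (auto simp: cyc_def)
        then show False using no_blue True by fastforce
      qed
      have "embeds R ?A"
      proof (rule embeds_clique)
        show "finite ?A" using finite_V by simp
        show "card W \<le> card ?A" using P(3) x card_W by simp
        show "R y z" if "y \<in> ?A" "z \<in> ?A" "y \<noteq> z" for y z
          using clique[OF that] that by (simp add: R_def)
      qed
      then show ?thesis by (rule embeds_mono) auto
    qed (use core in auto)
  next
    case False
    then have m2: "2 \<le> m" using m by simp
    from peel[of "3 * m + 1"] show ?thesis
    proof
      assume "\<exists>P\<subseteq>V. card P = 3 * m + 1 \<and> (\<forall>x\<in>P. n + 1 \<le> card {y \<in> V - P. B x y} + (3 * m + 1))"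
      then show ?thesis using embeds_if_many_hubs[OF m2] by blast
    qed (use core in auto)
  qed
qed

end

subsection \<open>The Ramsey number\<close>

text \<open>Cutting \<open>{..<N}\<close> at \<open>n - 1\<close> leaves two parts of at most
  \<open>n - 1\<close> vertices. Connectedness keeps a copy of \<open>T\<close> within one part, and
  an odd cycle cannot alternate between the parts. All smaller \<open>N\<close> are treated alike,
  so monotonicity in \<open>N\<close> need not be proved.\<close>

lemma ramsey_lower_bound:
  assumes T: "tree_graph T" "card (verts T) = n" and k: "3 \<le> k" "odd k"
    and N: "0 < N" "N < 2 * n - 1"
  shows "\<exists>\<Gamma> :: nat sgraph. simple_graph \<Gamma> \<and> card (verts \<Gamma>) = N \<and>
    \<not> contains_subgraph \<Gamma> (add_edge T u v) \<and> \<not> contains_subgraph (complement \<Gamma>) (cycle_graph k)"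
proof -
  define s where "s x \<longleftrightarrow> x < n - 1" for x :: nat
  define G :: "nat sgraph" where
    "G = \<lparr>verts = {..<N}, edges = {e. e \<subseteq> {..<N} \<and> card e = 2 \<and> (\<forall>x\<in>e. \<forall>y\<in>e. s x = s y)}\<rparr>"
  have eG: "edges G = {e. e \<subseteq> {..<N} \<and> card e = 2 \<and> (\<forall>x\<in>e. \<forall>y\<in>e. s x = s y)}" and vG: "verts G = {..<N}"
    by (simp_all add: G_def)
  have G: "s x = s y" if "{x, y} \<in> edges G" for x y
    using that unfolding eG by blast
  have Gc: "s x \<noteq> s y" if "{x, y} \<in> edges (complement G)" for x y
  proof
    assume "s x = s y"
    then have "\<forall>a\<in>{x, y}. \<forall>b\<in>{x, y}. s a = s b" by blast
    moreover have "{x, y} \<subseteq> {..<N} \<and> card {x, y} = 2 \<and> {x, y} \<notin> edges G"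
      using that by (simp add: complement_def vG)
    ultimately show False unfolding eG by blast
  qed
  have "\<not> contains_subgraph G (add_edge T u v)"
  proof
    assume "contains_subgraph G (add_edge T u v)"
    then obtain f where f: "inj_on f (verts T)" "f ` verts T \<subseteq> {..<N}" "\<forall>e\<in>insert {u, v} (edges T). f ` e \<in> edges G"
      by (auto simp: contains_subgraph_def add_edge_def vG)
    have same: "s (f x) = s (f y)" if "(x, y) \<in> {(x, y). {x, y} \<in> edges T}\<^sup>*" for x y
      using that
    proof (induction rule: rtrancl_induct)
      case (step y z)
      then have "{f y, f z} \<in> edges G" using f(3) by force
      then show ?case using step G by blast
    qed simp
    obtain r where r: "r \<in> verts T" using T(1) by (auto simp: tree_graph_def connected_graph_def)
    have sr: "s (f x) = s (f r)" if "x \<in> verts T" for x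
      using T(1) that r same by (auto simp: tree_graph_def connected_graph_def)
    have "f x \<in> (if s (f r) then {..<n - 1} else {n - 1..<N})" if "x \<in> verts T" for x
      using that f(2) sr[OF that] by (auto simp: s_def image_subset_iff)
    then have "f ` verts T \<subseteq> {..<n - 1} \<or> f ` verts T \<subseteq> {n - 1..<N}"
      by (cases "s (f r)") auto
    then have "card (f ` verts T) \<le> n - 1"
    proof
      assume "f ` verts T \<subseteq> {..<n - 1}"
      then show ?thesis using card_mono[of "{..<n - 1}" "f ` verts T"] by simp
    next
      assume "f ` verts T \<subseteq> {n - 1..<N}"
      then show ?thesis using card_mono[of "{n - 1..<N}" "f ` verts T"] N by simp
    qed
    then show False using f(1) T(2) N by (simp add: card_image)
  qed
  moreover have "\<not> contains_subgraph (complement G) (cycle_graph k)"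
  proof
    assume "contains_subgraph (complement G) (cycle_graph k)"
    then obtain f where f: "\<forall>e\<in>{{i, (i + 1) mod k} |i. i < k}. f ` e \<in> edges (complement G)"
      by (auto simp: contains_subgraph_def cycle_graph_def)
    have step: "s (f i) \<noteq> s (f ((i + 1) mod k))" if "i < k" for i
    proof -
      have "f ` {i, (i + 1) mod k} \<in> edges (complement G)" using f that by blast
      then show ?thesis using Gc by simp
    qed
    have alt: "s (f i) = (s (f 0) = even i)" if "i < k" for i
      using that
    proof (induction i)
      case (Suc i)
      then show ?case using step[of i] by auto
    qed simp
    have "s (f (k - 1)) \<noteq> s (f 0)" using step[of "k - 1"] k by simp
    then show False using alt[of "k - 1"] k by simp
  qed
  moreover have "simple_graph G" "card (verts G) = N" by (auto simp: G_def simple_graph_def)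
  ultimately show ?thesis by blast
qed

theorem lemma5p1:
  fixes k n :: nat and T :: "'a sgraph" and u v :: 'a
  assumes "k \<ge> 3" and "odd k" and "n \<ge> 7 * k - 4"
    and "tree_graph T" and "card (verts T) = n"
    and "u \<in> verts T" and "v \<in> verts T" and "u \<noteq> v" and "{u, v} \<notin> edges T"
  shows "ramsey_number (add_edge T u v) (cycle_graph k) = 2 * n - 1"
  unfolding ramsey_number_def
proof (rule Least_equality)
  have upper: "contains_subgraph \<Gamma> (add_edge T u v)"
    if G: "simple_graph \<Gamma>" "card (verts \<Gamma>) = 2 * n - 1"
      and no: "\<not> contains_subgraph (complement \<Gamma>) (cycle_graph k)" for \<Gamma> :: "nat sgraph"
  proof -
    define B where "B x y \<longleftrightarrow> {x, y} \<in> edges (complement \<Gamma>)" for x y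
    from \<open>odd k\<close> obtain m where m: "k = 2 * m + 1" by (rule oddE)
    have BV: "x \<in> verts \<Gamma> \<and> y \<in> verts \<Gamma> \<and> x \<noteq> y" if "B x y" for x y
      using that by (auto simp: B_def complement_def card_insert_if split: if_splits)
    interpret host "verts \<Gamma>" B m n T u v
    proof
      show "finite (verts \<Gamma>)" using G(1) by (simp add: simple_graph_def)
      show "card (verts \<Gamma>) + 1 = 2 * n" using G(2) assms(1,3) by simp
      show "length xs \<noteq> 2 * m + 1" if "cyc B xs" for xs
      proof
        assume "length xs = 2 * m + 1"
        moreover have "set xs \<subseteq> verts (complement \<Gamma>)"
          using cyc_subset[OF that, of "verts \<Gamma>"] BV by (simp add: complement_def)
        ultimately show False
          using cyc_imp_contains_cycle_graph[of "complement \<Gamma>" xs] that no by (simp add: m B_def[abs_def])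
      qed
      show "B y x" if "B x y" for x y using that by (simp add: B_def insert_commute)
      show "\<not> B x x" "B x y \<Longrightarrow> x \<in> verts \<Gamma>" for x y using BV by blast+
    qed (use assms m in auto)
    obtain f where f: "inj_on f (verts T)" "f ` verts T \<subseteq> verts \<Gamma>"
      "\<forall>x\<in>verts T. \<forall>y\<in>verts T. adj x y \<longrightarrow> R (f x) (f y)"
      using embeds_red by (auto simp: embeds_def)
    have red: "{x, y} \<in> edges \<Gamma>" if "R x y" for x y
      using that by (auto simp: R_def B_def complement_def)
    have "f ` e \<in> edges \<Gamma>" if "e \<in> insert {u, v} (edges T)" for e
    proof -
      have "\<exists>x y. e = {x, y} \<and> x \<in> verts T \<and> y \<in> verts T \<and> adj x y"
        using that assms(6,7) edge_cases by (auto simp: adj_def) metis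
      then show ?thesis using f(3) red by force
    qed
    then show ?thesis
      unfolding contains_subgraph_def using f(1,2) by (intro exI[of _ f]) (simp add: add_edge_def)
  qed
  show "2 * n - 1 > 0 \<and> (\<forall>\<Gamma> :: nat sgraph. simple_graph \<Gamma> \<and> card (verts \<Gamma>) = 2 * n - 1 \<longrightarrow>
      contains_subgraph \<Gamma> (add_edge T u v) \<or> contains_subgraph (complement \<Gamma>) (cycle_graph k))"
    using upper assms(1,3) by auto
  show "2 * n - 1 \<le> N" if "N > 0 \<and> (\<forall>\<Gamma> :: nat sgraph. simple_graph \<Gamma> \<and> card (verts \<Gamma>) = N \<longrightarrow>
      contains_subgraph \<Gamma> (add_edge T u v) \<or> contains_subgraph (complement \<Gamma>) (cycle_graph k))" for N
    using ramsey_lower_bound[OF assms(4,5,1,2), of N u v] that by (meson not_le)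
qed

end
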